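(* Let $X$ and $Y$ be arc fields satisfying Conditions E1 and E2 on a locally complete metric space $M$, and let $F$ and $G$ be the local flows of $X$ and $Y$. Then $[F,G]\sim 0$ if and only if $F$ and $G$ commute, i.e. $$F_tG_s(x)=G_sF_t(x),$$ equivalently $F_t^{\ast}(G)=G$, where the identity is understood locally: for each $x_0\in M$ there is $\delta>0$ such that it holds for all $x\in B(x_0,\delta)$ and $|s|,|t|<\delta$.
   Context: $(M,d)$ is locally complete if each point has a complete neighborhood. $B(x,r)$ is the open ball. An arc field on $M$ is a continuous map $X:M\times[-1,1]\to M$ with $X(x,0)=x$, such that $\rho(x):=\sup_{s\ne t} d(X(x,s),X(x,t))/|s-t|<\infty$ for each $x$ and $\rho$ is locally bounded. Write $X(x,t)=X_x(t)=X_t(x)$ and $Y_tX_s(x)=Y_t(X_s(x))$. Only the behavior of an arc field for $t$ near $0$ is of concern. Condition E1: for each $x_0$ there are $r,\delta,\Lambda_X>0$ with $d(X_t(x),X_t(y))\le d(x,y)(1+|t|\Lambda_X)$ for all $x,y\in B(x_0,r)$, $|t|<\delta$. Condition E2: for each $x_0$ there are $r,\delta,\Omega_X>0$ with $d(X_{s+t}(x),X_tX_s(x))\le|st|\Omega_X$ for all $x\in B(x_0,r)$, $|s|,|t|<\delta$. A solution curve to $X$ is a continuous $\sigma:(\alpha,\beta)\to M$ with $\lim_{h\to0} d(\sigma(t+h),X(\sigma(t),h))/h=0$ for each $t$. If $X$ satisfies E1 and E2 it is known that there is a unique maximal solution $\sigma_x:(\alpha_x,\beta_x)\to M$ with $\sigma_x(0)=x$;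 the local flow of $X$ is $F_t(x)=F(x,t):=\sigma_x(t)$. A local flow is regarded as an arc field by using $F(x,t)$ for $t\in(\alpha_x/2,\beta_x/2)$ and extending to other $t\in[-1,1]$ by constants. Bracket: $[F,G]_t(x):=G_{-\sqrt t}F_{-\sqrt t}G_{\sqrt t}F_{\sqrt t}(x)$ for $t\ge0$, and $[F,G]_t(x):=F_{-\sqrt{|t|}}G_{-\sqrt{|t|}}F_{\sqrt{|t|}}G_{\sqrt{|t|}}(x)$ for $t<0$. $0$ is the constant arc field $0(x,t)=x$. $[F,G]\sim0$ means $d([F,G]_t(x),x)=o(t)$ locally uniformly in $x$: for each $x_0$ there is $r>0$ such that for every $\varepsilon>0$ there is $\delta>0$ with $d([F,G]_t(x),x)<\varepsilon|t|$ for all $x\in B(x_0,r)$, $0<|t|<\delta$. Pull-back: $(F_t^{\ast}G)_s(x):=F_{-t}G_sF_t(x)$. *)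

theory Defs
  imports "HOL-Analysis.Analysis"
begin

definition locally_complete :: "'a::metric_space itself \<Rightarrow> bool" where
  "locally_complete _ \<longleftrightarrow> (\<forall>x::'a. \<exists>U. x \<in> interior U \<and> complete U)"

text \<open>
  A map on \<open>M \<times> [-1,1]\<close> is represented by a total curried function \<open>X x t\<close>;
  its values for \<open>\<bar>t\<bar> > 1\<close> carry no meaning, and the bounds \<open>\<delta>\<close> below can always be
  shrunk so as not to involve them. The speed is taken
  in the extended reals, so that the supremum is the true one also when it is infinite.
\<close>

definition arc_speed :: "('a::metric_space \<Rightarrow> real \<Rightarrow> 'a) \<Rightarrow> 'a \<Rightarrow> ereal" where
  "arc_speed X x =
     (SUP (s, t) \<in> {(s, t). s \<in> {-1..1} \<and> t \<in> {-1..1} \<and> s \<noteq> t}.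
        ereal (dist (X x s) (X x t) / \<bar>s - t\<bar>))"

definition arc_field :: "('a::metric_space \<Rightarrow> real \<Rightarrow> 'a) \<Rightarrow> bool" where
  "arc_field X \<longleftrightarrow>
     continuous_on (UNIV \<times> {-1..1}) (\<lambda>(x, t). X x t) \<and>
     (\<forall>x. X x 0 = x) \<and>
     (\<forall>x. arc_speed X x < \<infinity>) \<and>
     (\<forall>x\<^sub>0. \<exists>r>0. \<exists>C::real. \<forall>x\<in>ball x\<^sub>0 r. arc_speed X x \<le> ereal C)"

definition cond_E1 :: "('a::metric_space \<Rightarrow> real \<Rightarrow> 'a) \<Rightarrow> bool" where
  "cond_E1 X \<longleftrightarrow>
     (\<forall>x\<^sub>0. \<exists>r>0. \<exists>\<delta>>0. \<exists>\<Lambda>>0. \<forall>x\<in>ball x\<^sub>0 r. \<forall>y\<in>ball x\<^sub>0 r. \<forall>t. \<bar>t\<bar> < \<delta> \<longrightarrow>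
        dist (X x t) (X y t) \<le> dist x y * (1 + \<bar>t\<bar> * \<Lambda>))"

definition cond_E2 :: "('a::metric_space \<Rightarrow> real \<Rightarrow> 'a) \<Rightarrow> bool" where
  "cond_E2 X \<longleftrightarrow>
     (\<forall>x\<^sub>0. \<exists>r>0. \<exists>\<delta>>0. \<exists>\<Omega>>0. \<forall>x\<in>ball x\<^sub>0 r. \<forall>s t. \<bar>s\<bar> < \<delta> \<longrightarrow> \<bar>t\<bar> < \<delta> \<longrightarrow>
        dist (X x (s + t)) (X (X x s) t) \<le> \<bar>s * t\<bar> * \<Omega>)"

text \<open>The endpoints of an interval of definition may be infinite.\<close>

definition solution_curve ::
  "('a::metric_space \<Rightarrow> real \<Rightarrow> 'a) \<Rightarrow> ereal \<Rightarrow> ereal \<Rightarrow> (real \<Rightarrow> 'a) \<Rightarrow> bool" where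
  "solution_curve X \<alpha> \<beta> \<sigma> \<longleftrightarrow>
     \<alpha> < \<beta> \<and> continuous_on (einterval \<alpha> \<beta>) \<sigma> \<and>
     (\<forall>t\<in>einterval \<alpha> \<beta>. ((\<lambda>h. dist (\<sigma> (t + h)) (X (\<sigma> t) h) / h) \<longlongrightarrow> 0) (at 0))"

definition maximal_solution ::
  "('a::metric_space \<Rightarrow> real \<Rightarrow> 'a) \<Rightarrow> 'a \<Rightarrow> ereal \<Rightarrow> ereal \<Rightarrow> (real \<Rightarrow> 'a) \<Rightarrow> bool" where
  "maximal_solution X x \<alpha> \<beta> \<sigma> \<longleftrightarrow>
     solution_curve X \<alpha> \<beta> \<sigma> \<and> 0 \<in> einterval \<alpha> \<beta> \<and> \<sigma> 0 = x \<and>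
     (\<forall>\<alpha>' \<beta>' \<sigma>'. solution_curve X \<alpha>' \<beta>' \<sigma>' \<longrightarrow> einterval \<alpha> \<beta> \<subseteq> einterval \<alpha>' \<beta>' \<longrightarrow>
        (\<forall>t\<in>einterval \<alpha> \<beta>. \<sigma>' t = \<sigma> t) \<longrightarrow> \<alpha>' = \<alpha> \<and> \<beta>' = \<beta>)"

text \<open>
  The local flow, regarded as an arc field: maximal solutions restricted to
  \<open>(\<alpha>/2, \<beta>/2)\<close> and continued by their (constant) values at the endpoints \<open>\<alpha>/2\<close> and \<open>\<beta>/2\<close>.
  The conversion \<open>real_of_ereal\<close> is only reached when the endpoint in question is finite.
\<close>

definition local_flow ::
  "('a::metric_space \<Rightarrow> real \<Rightarrow> 'a) \<Rightarrow> ('a \<Rightarrow> real \<Rightarrow> 'a) \<Rightarrow> bool" where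
  "local_flow X F \<longleftrightarrow>
     (\<forall>x. \<exists>\<alpha> \<beta> \<sigma>. maximal_solution X x \<alpha> \<beta> \<sigma> \<and>
        (\<forall>t\<in>{-1..1}. F x t =
           (if ereal t \<le> \<alpha> / 2 then \<sigma> (real_of_ereal (\<alpha> / 2))
            else if \<beta> / 2 \<le> ereal t then \<sigma> (real_of_ereal (\<beta> / 2))
            else \<sigma> t)))"

definition arc_bracket ::
  "('a \<Rightarrow> real \<Rightarrow> 'a) \<Rightarrow> ('a \<Rightarrow> real \<Rightarrow> 'a) \<Rightarrow> 'a \<Rightarrow> real \<Rightarrow> 'a" where
  "arc_bracket F G x t =
     (if 0 \<le> t
      then G (F (G (F x (sqrt t)) (sqrt t)) (- sqrt t)) (- sqrt t)
      else F (G (F (G x (sqrt \<bar>t\<bar>)) (sqrt \<bar>t\<bar>)) (- sqrt \<bar>t\<bar>)) (- sqrt \<bar>t\<bar>))"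

definition zero_arc :: "'a \<Rightarrow> real \<Rightarrow> 'a" where
  "zero_arc x t = x"

definition arc_tangent ::
  "('a::metric_space \<Rightarrow> real \<Rightarrow> 'a) \<Rightarrow> ('a \<Rightarrow> real \<Rightarrow> 'a) \<Rightarrow> bool" where
  "arc_tangent X Y \<longleftrightarrow>
     (\<forall>x\<^sub>0. \<exists>r>0. \<forall>\<epsilon>>0. \<exists>\<delta>>0. \<forall>x\<in>ball x\<^sub>0 r. \<forall>t. 0 < \<bar>t\<bar> \<longrightarrow> \<bar>t\<bar> < \<delta> \<longrightarrow>
        dist (X x t) (Y x t) < \<epsilon> * \<bar>t\<bar>)"

definition arc_pullback ::
  "('a \<Rightarrow> real \<Rightarrow> 'a) \<Rightarrow> real \<Rightarrow> ('a \<Rightarrow> real \<Rightarrow> 'a) \<Rightarrow> 'a \<Rightarrow> real \<Rightarrow> 'a" where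
  "arc_pullback F t G x s = F (G (F x t) s) (- t)"

definition locally_commute ::
  "('a::metric_space \<Rightarrow> real \<Rightarrow> 'a) \<Rightarrow> ('a \<Rightarrow> real \<Rightarrow> 'a) \<Rightarrow> bool" where
  "locally_commute F G \<longleftrightarrow>
     (\<forall>x\<^sub>0. \<exists>\<delta>>0. \<forall>x\<in>ball x\<^sub>0 \<delta>. \<forall>s t. \<bar>s\<bar> < \<delta> \<longrightarrow> \<bar>t\<bar> < \<delta> \<longrightarrow>
        F (G x s) t = G (F x t) s)"

definition locally_pullback_invariant ::
  "('a::metric_space \<Rightarrow> real \<Rightarrow> 'a) \<Rightarrow> ('a \<Rightarrow> real \<Rightarrow> 'a) \<Rightarrow> bool" where
  "locally_pullback_invariant F G \<longleftrightarrow>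
     (\<forall>x\<^sub>0. \<exists>\<delta>>0. \<forall>x\<in>ball x\<^sub>0 \<delta>. \<forall>s t. \<bar>s\<bar> < \<delta> \<longrightarrow> \<bar>t\<bar> < \<delta> \<longrightarrow>
        arc_pullback F t G x s = G x s)"

end

theory Submission
  imports Defs
begin

text \<open>
  The flow of each arc field is, near a point, a group of uniformly Lipschitz maps with bounded
  speed. Granting this, the theorem is a discrete Stokes argument. A bracket of size
  \<open>o(h\<^sup>2)\<close> at parameter \<open>h\<^sup>2\<close> says that \<open>F\<^sub>h\<close> and \<open>G\<^sub>h\<close> commute up to \<open>o(h\<^sup>2)\<close>. To
  compare \<open>F\<^sub>t G\<^sub>s\<close> with \<open>G\<^sub>s F\<^sub>t\<close>, cut the rectangle with sides \<open>s\<close> and \<open>t\<close> into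
  squares of side \<open>h\<close> and pass from one corner path to the other by crossing one square at a
  time. There are about \<open>st/h\<^sup>2\<close> squares. Since the rest of the path is a single flow map
  applied after the crossing, each crossing costs only a fixed multiple of \<open>o(h\<^sup>2)\<close>
  (\<open>swap_steps\<close>, \<open>grid_swap\<close>), so the total tends to \<open>0\<close> with \<open>h\<close>
  (\<open>small_bracket_imp_commute_nonneg\<close>). Negative times follow by moving the base point along the
  flow. In the other direction, commuting flows make the bracket equal to the identity for small
  \<open>t\<close>, and the pull-back form differs from the commutation identity by one application of
  the inverse of \<open>F\<^sub>t\<close>.

  What the flows have to satisfy is collected in the locale \<open>flow_box\<close>. The Lipschitz bound in
  space and the uniqueness behind the group law are a Gronwall estimate derived from Condition E1
  (\<open>solution_spread\<close>). The delicate point is that the maximal solutions starting near \<open>x\<^sub>0\<close>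
  exist for a common time (\<open>lifetime_forward\<close>): with bounded speed, a solution that ended too
  early would be Lipschitz inside a complete set, hence would converge at its end point, and the
  solution through the limit point would extend it.
\<close>

section \<open>Growth estimates for solutions\<close>

text \<open>
  A function may be bounded from its right-hand increments alone. Nothing is asked to the left of
  \<open>t\<close>, because for the distance of two solutions Condition E1 bounds the increments only in the
  direction of motion. The slope condition may use the bound already reached at \<open>t\<close>; this
  is what keeps a solution inside a ball while its speed is being estimated there.
\<close>
lemma growth_by_right_slopes:
  fixes \<phi> :: "real \<Rightarrow> real"
  assumes cont: "continuous_on {a..b} \<phi>"
    and slope: "\<And>t. a \<le> t \<Longrightarrow> t < b \<Longrightarrow> \<phi> t \<le> \<phi> a + K * (t - a) \<Longrightarrow>
      \<exists>\<eta>>0. \<forall>h. 0 < h \<longrightarrow> h < \<eta> \<longrightarrow> \<phi> (t + h) \<le> \<phi> t + K * h"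
    and "a \<le> b"
  shows "\<phi> b \<le> \<phi> a + K * (b - a)"
proof (rule ccontr)
  assume neg: "\<not> ?thesis"
  \<comment> \<open>At the last point where the bound holds, the slope condition pushes the bound further.\<close>
  define \<psi> where "\<psi> t = \<phi> t - K * (t - a)" for t
  define A where "A = {t \<in> {a..b}. \<psi> t \<le> \<phi> a}"
  have "continuous_on {a..b} \<psi>"
    unfolding \<psi>_def by (intro continuous_intros cont)
  then have "closed A"
    unfolding A_def by (intro continuous_on_closed_Collect_le continuous_intros) auto
  moreover have "a \<in> A" using \<open>a \<le> b\<close> by (auto simp: A_def \<psi>_def)
  moreover have bdd: "bdd_above A" by (auto simp: A_def intro!: bdd_aboveI[of _ b])
  ultimately have c: "Sup A \<in> A" by (intro closed_contains_Sup) auto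
  define c where "c = Sup A"
  have c1: "a \<le> c" "c \<le> b" "\<psi> c \<le> \<phi> a" using c by (auto simp: A_def c_def)
  have "c \<noteq> b" using c1 neg by (auto simp: \<psi>_def)
  then have "c < b" using c1 by simp
  then obtain \<eta> where "\<eta> > 0" and \<eta>: "\<And>h. 0 < h \<Longrightarrow> h < \<eta> \<Longrightarrow> \<phi> (c + h) \<le> \<phi> c + K * h"
    using slope[of c] c1 by (auto simp: \<psi>_def)
  define h where "h = min (\<eta>/2) (b - c)"
  have "0 < h" "h < \<eta>" "c + h \<le> b" using \<open>\<eta> > 0\<close> \<open>c < b\<close> by (auto simp: h_def)
  then have "c + h \<in> A"
    using \<eta>[of h] c1 by (auto simp: A_def \<psi>_def algebra_simps)
  then have "c + h \<le> c" unfolding c_def using bdd by (intro cSup_upper) (auto simp: c_def)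
  then show False using \<open>0 < h\<close> by simp
qed

text \<open>
  The pointwise condition on a solution curve, separated from its interval of definition so that
  restriction, translation and gluing become statements about single times.
\<close>
definition solves_at :: "('a::metric_space \<Rightarrow> real \<Rightarrow> 'a) \<Rightarrow> (real \<Rightarrow> 'a) \<Rightarrow> real \<Rightarrow> bool" where
  "solves_at X \<sigma> t \<longleftrightarrow> ((\<lambda>h. dist (\<sigma> (t + h)) (X (\<sigma> t) h) / h) \<longlongrightarrow> 0) (at 0)"

lemma solves_at_iff:
  "solves_at X \<sigma> t \<longleftrightarrow>
    (\<forall>\<epsilon>>0. \<exists>\<eta>>0. \<forall>h. 0 < \<bar>h\<bar> \<longrightarrow> \<bar>h\<bar> < \<eta> \<longrightarrow> dist (\<sigma> (t + h)) (X (\<sigma> t) h) < \<epsilon> * \<bar>h\<bar>)"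
proof -
  have *: "(h \<in> UNIV \<longrightarrow> h \<noteq> 0 \<and> dist h 0 < \<eta> \<longrightarrow> dist (dist (\<sigma> (t + h)) (X (\<sigma> t) h) / h) 0 < \<epsilon>)
    \<longleftrightarrow> (0 < \<bar>h\<bar> \<longrightarrow> \<bar>h\<bar> < \<eta> \<longrightarrow> dist (\<sigma> (t + h)) (X (\<sigma> t) h) < \<epsilon> * \<bar>h\<bar>)" for h \<epsilon> \<eta>
    by (cases "h = 0") (simp_all add: dist_real_def abs_divide pos_divide_less_eq)
  show ?thesis
    unfolding solves_at_def tendsto_iff eventually_at Ball_def by (simp only: *)
qed

lemma solves_atD:
  assumes "solves_at X \<sigma> t" "\<epsilon> > 0"
  shows "\<exists>\<eta>>0. \<forall>h. 0 < \<bar>h\<bar> \<longrightarrow> \<bar>h\<bar> < \<eta> \<longrightarrow> dist (\<sigma> (t + h)) (X (\<sigma> t) h) < \<epsilon> * \<bar>h\<bar>"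
  using assms unfolding solves_at_iff by blast

lemma solves_at_cong:
  assumes "solves_at X \<sigma> t" "open U" "t \<in> U" "\<And>u. u \<in> U \<Longrightarrow> \<tau> u = \<sigma> u"
  shows "solves_at X \<tau> t"
proof -
  obtain e where "e > 0" and e: "ball t e \<subseteq> U" using assms(2,3) open_contains_ball by blast
  have "dist (\<sigma> (t + h)) (X (\<sigma> t) h) / h = dist (\<tau> (t + h)) (X (\<tau> t) h) / h" if "dist h 0 < e" for h
  proof -
    have "t + h \<in> U" using that e by (intro subsetD[OF e]) (simp add: dist_real_def)
    then show ?thesis using assms(3,4) by simp
  qed
  then have "\<forall>\<^sub>F h in at 0. dist (\<sigma> (t + h)) (X (\<sigma> t) h) / h = dist (\<tau> (t + h)) (X (\<tau> t) h) / h"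
    unfolding eventually_at using \<open>e > 0\<close> by blast
  then show ?thesis
    using assms(1) unfolding solves_at_def by (rule Lim_transform_eventually[rotated])
qed

lemma solves_at_shift: "solves_at X (\<lambda>u. \<sigma> (c + u)) t \<longleftrightarrow> solves_at X \<sigma> (c + t)"
  by (simp add: solves_at_def add.assoc)

text \<open>
  Time reversal turns forward estimates into backward ones; reversing the arc field preserves the
  bounds collected in the locale below.
\<close>
lemma solves_at_reverse:
  assumes "solves_at X \<sigma> (- t)"
  shows "solves_at (\<lambda>x h. X x (- h)) (\<lambda>u. \<sigma> (- u)) t"
  unfolding solves_at_iff
proof (intro allI impI)
  fix \<epsilon> :: real assume "\<epsilon> > 0"
  with assms obtain \<eta> where "\<eta> > 0" and
    "\<And>h. 0 < \<bar>h\<bar> \<Longrightarrow> \<bar>h\<bar> < \<eta> \<Longrightarrow> dist (\<sigma> (- t + h)) (X (\<sigma> (- t)) h) < \<epsilon> * \<bar>h\<bar>"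
    unfolding solves_at_iff by blast
  from this(1) this(2)[of "- h" for h]
  show "\<exists>\<eta>>0. \<forall>h. 0 < \<bar>h\<bar> \<longrightarrow> \<bar>h\<bar> < \<eta> \<longrightarrow>
      dist (\<sigma> (- (t + h))) (X (\<sigma> (- t)) (- h)) < \<epsilon> * \<bar>h\<bar>"
    by (intro exI[of _ \<eta>]) (simp add: add.commute)
qed

text \<open>
  The bounds that local boundedness of the speed and Condition E1 provide on a set \<open>S\<close>.
  Convergence of \<open>X y h\<close> to \<open>y\<close> is asked for every \<open>y\<close> so that solutions are continuous before
  they are known to stay in \<open>S\<close>.
\<close>
locale arc_region =
  fixes X :: "'a::metric_space \<Rightarrow> real \<Rightarrow> 'a" and S :: "'a set" and C\<^sub>0 \<Lambda> \<delta> :: real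
  assumes \<delta>_pos: "\<delta> > 0" and \<Lambda>_nonneg: "\<Lambda> \<ge> 0"
    and start: "(X y \<longlongrightarrow> y) (at 0)"
    and speed: "y \<in> S \<Longrightarrow> \<bar>h\<bar> < \<delta> \<Longrightarrow> dist (X y h) y \<le> C\<^sub>0 * \<bar>h\<bar>"
    and spread: "y \<in> S \<Longrightarrow> z \<in> S \<Longrightarrow> \<bar>h\<bar> < \<delta> \<Longrightarrow> dist (X y h) (X z h) \<le> dist y z * (1 + \<bar>h\<bar> * \<Lambda>)"
begin

lemma reverse: "arc_region (\<lambda>x h. X x (- h)) S C\<^sub>0 \<Lambda> \<delta>"
proof
  show "((\<lambda>h. X y (- h)) \<longlongrightarrow> y) (at 0)" for y
    by (rule tendsto_compose_eventually[OF start])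
      (auto intro!: tendsto_eq_intros simp: eventually_at_filter)
qed (use speed[of _ "- h" for h] spread[of _ _ "- h" for h] \<delta>_pos \<Lambda>_nonneg in auto)

lemma solves_at_isCont:
  assumes "solves_at X \<sigma> t"
  shows "isCont \<sigma> t"
proof -
  have "((\<lambda>h. dist (\<sigma> (t + h)) (X (\<sigma> t) h) / h * h) \<longlongrightarrow> 0) (at 0)"
    using assms unfolding solves_at_def by (intro tendsto_mult_zero tendsto_ident_at)
  then have "((\<lambda>h. dist (\<sigma> (t + h)) (X (\<sigma> t) h)) \<longlongrightarrow> 0) (at 0)"
    by (rule Lim_transform_eventually) (simp add: eventually_at_filter)
  moreover have "((\<lambda>h. dist (X (\<sigma> t) h) (\<sigma> t)) \<longlongrightarrow> 0) (at 0)"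
    using start[of "\<sigma> t"] by (subst (asm) tendsto_dist_iff)
  ultimately have "((\<lambda>h. dist (\<sigma> (t + h)) (X (\<sigma> t) h) + dist (X (\<sigma> t) h) (\<sigma> t)) \<longlongrightarrow> 0) (at 0)"
    by (rule tendsto_add_zero)
  then have "((\<lambda>h. dist (\<sigma> (t + h)) (\<sigma> t)) \<longlongrightarrow> 0) (at 0)"
    by (rule Lim_null_comparison[rotated]) (intro always_eventually allI, simp add: dist_triangle)
  then show ?thesis
    unfolding isCont_iff by (subst tendsto_dist_iff)
qed

text \<open>
  Solutions inherit the speed of the arc field. The strict inequality \<open>C\<^sub>0 < C\<close> absorbs the
  \<open>o(h)\<close> error of a solution, and membership in \<open>S\<close> need only follow from the bound itself.
\<close>
lemma speed_forward:
  assumes "0 \<le> t" and "C\<^sub>0 < C"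
    and sol: "\<And>u. 0 \<le> u \<Longrightarrow> u \<le> t \<Longrightarrow> solves_at X \<sigma> u"
    and stay: "\<And>u. 0 \<le> u \<Longrightarrow> u < t \<Longrightarrow> dist (\<sigma> u) (\<sigma> 0) \<le> C * u \<Longrightarrow> \<sigma> u \<in> S"
  shows "dist (\<sigma> t) (\<sigma> 0) \<le> C * t"
proof -
  have "dist (\<sigma> t) (\<sigma> 0) \<le> dist (\<sigma> 0) (\<sigma> 0) + C * (t - 0)"
  proof (rule growth_by_right_slopes)
    show "continuous_on {0..t} (\<lambda>u. dist (\<sigma> u) (\<sigma> 0))"
      using sol solves_at_isCont
      by (intro continuous_on_dist continuous_on_const continuous_at_imp_continuous_on) auto
  next
    fix u assume u: "0 \<le> u" "u < t" "dist (\<sigma> u) (\<sigma> 0) \<le> dist (\<sigma> 0) (\<sigma> 0) + C * (u - 0)"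
    then have S: "\<sigma> u \<in> S" using stay by simp
    from sol[of u] u \<open>C\<^sub>0 < C\<close> obtain \<eta> where "\<eta> > 0" and
      \<eta>: "\<And>h. 0 < \<bar>h\<bar> \<Longrightarrow> \<bar>h\<bar> < \<eta> \<Longrightarrow> dist (\<sigma> (u + h)) (X (\<sigma> u) h) < (C - C\<^sub>0) * \<bar>h\<bar>"
      using solves_atD[of X \<sigma> u "C - C\<^sub>0"] by auto
    have "dist (\<sigma> (u + h)) (\<sigma> 0) \<le> dist (\<sigma> u) (\<sigma> 0) + C * h" if "0 < h" "h < min \<eta> \<delta>" for h
    proof -
      have "dist (\<sigma> (u + h)) (\<sigma> 0) \<le>
          dist (\<sigma> (u + h)) (X (\<sigma> u) h) + dist (X (\<sigma> u) h) (\<sigma> u) + dist (\<sigma> u) (\<sigma> 0)"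
        by metric
      then show ?thesis using \<eta>[of h] speed[OF S, of h] that by (simp add: algebra_simps)
    qed
    then show "\<exists>\<eta>>0. \<forall>h. 0 < h \<longrightarrow> h < \<eta> \<longrightarrow> dist (\<sigma> (u + h)) (\<sigma> 0) \<le> dist (\<sigma> u) (\<sigma> 0) + C * h"
      using \<open>\<eta> > 0\<close> \<delta>_pos by (intro exI[of _ "min \<eta> \<delta>"]) auto
  qed (fact \<open>0 \<le> t\<close>)
  then show ?thesis by simp
qed

text \<open>
  Gronwall's inequality: the \<open>1 + h\<Lambda>\<close> of Condition E1 is at most \<open>exp (\<Lambda> h)\<close>, so the distance
  multiplied by \<open>exp (- \<Lambda> t)\<close> has right-hand increments of size \<open>o(h)\<close> and cannot grow.
\<close>
lemma spread_forward:
  assumes "0 \<le> t"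
    and sol: "\<And>u. 0 \<le> u \<Longrightarrow> u \<le> t \<Longrightarrow> solves_at X \<sigma> u \<and> solves_at X \<tau> u \<and> \<sigma> u \<in> S \<and> \<tau> u \<in> S"
  shows "dist (\<sigma> t) (\<tau> t) \<le> exp (\<Lambda> * t) * dist (\<sigma> 0) (\<tau> 0)"
proof -
  define \<phi> where "\<phi> u = exp (- \<Lambda> * u) * dist (\<sigma> u) (\<tau> u)" for u
  have "\<phi> t \<le> \<phi> 0 + K * (t - 0)" if "K > 0" for K
  proof (rule growth_by_right_slopes)
    show "continuous_on {0..t} \<phi>"
      unfolding \<phi>_def using sol solves_at_isCont
      by (intro continuous_intros continuous_at_imp_continuous_on) auto
  next
    fix u assume u: "0 \<le> u" "u < t"
    note S = sol[of u]
    from S u \<open>K > 0\<close> obtain \<eta>1 where "\<eta>1 > 0" and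
      \<eta>1: "\<And>h. 0 < \<bar>h\<bar> \<Longrightarrow> \<bar>h\<bar> < \<eta>1 \<Longrightarrow> dist (\<sigma> (u + h)) (X (\<sigma> u) h) < (K/2) * \<bar>h\<bar>"
      using solves_atD[of X \<sigma> u "K/2"] by auto
    from S u \<open>K > 0\<close> obtain \<eta>2 where "\<eta>2 > 0" and
      \<eta>2: "\<And>h. 0 < \<bar>h\<bar> \<Longrightarrow> \<bar>h\<bar> < \<eta>2 \<Longrightarrow> dist (\<tau> (u + h)) (X (\<tau> u) h) < (K/2) * \<bar>h\<bar>"
      using solves_atD[of X \<tau> u "K/2"] by auto
    have "\<phi> (u + h) \<le> \<phi> u + K * h" if h: "0 < h" "h < min (min \<eta>1 \<eta>2) \<delta>" for h
    proof -
      have "dist (\<sigma> (u + h)) (\<tau> (u + h)) \<le>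
          dist (\<sigma> (u + h)) (X (\<sigma> u) h) + dist (X (\<sigma> u) h) (X (\<tau> u) h) + dist (\<tau> (u + h)) (X (\<tau> u) h)"
        by metric
      also have "\<dots> \<le> dist (\<sigma> u) (\<tau> u) * (1 + h * \<Lambda>) + K * h"
        using \<eta>1[of h] \<eta>2[of h] spread[of "\<sigma> u" "\<tau> u" h] S u h by (simp add: algebra_simps)
      also have "\<dots> \<le> dist (\<sigma> u) (\<tau> u) * exp (\<Lambda> * h) + K * h"
        using exp_ge_add_one_self[of "\<Lambda> * h"] by (intro add_right_mono mult_left_mono) (auto simp: mult.commute)
      finally have "\<phi> (u + h) \<le>
          exp (- \<Lambda> * (u + h)) * (dist (\<sigma> u) (\<tau> u) * exp (\<Lambda> * h) + K * h)"
        unfolding \<phi>_def by (intro mult_left_mono) auto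
      also have "\<dots> = \<phi> u + exp (- \<Lambda> * (u + h)) * (K * h)"
        by (simp add: \<phi>_def algebra_simps flip: exp_add)
      also have "\<dots> \<le> \<phi> u + 1 * (K * h)"
        using u h \<Lambda>_nonneg \<open>K > 0\<close> by (intro add_mono mult_right_mono) auto
      finally show ?thesis by simp
    qed
    then show "\<exists>\<eta>>0. \<forall>h. 0 < h \<longrightarrow> h < \<eta> \<longrightarrow> \<phi> (u + h) \<le> \<phi> u + K * h"
      using \<open>\<eta>1 > 0\<close> \<open>\<eta>2 > 0\<close> \<delta>_pos by (intro exI[of _ "min (min \<eta>1 \<eta>2) \<delta>"]) auto
  qed (fact \<open>0 \<le> t\<close>)
  then have K: "\<phi> t \<le> \<phi> 0 + K * t" if "K > 0" for K using that by simp
  have "\<phi> t \<le> \<phi> 0"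
  proof (rule field_le_epsilon)
    fix e :: real assume "e > 0"
    have "\<phi> t \<le> \<phi> 0 + e / (t + 1) * t" using \<open>e > 0\<close> \<open>0 \<le> t\<close> by (intro K) simp
    also have "\<dots> \<le> \<phi> 0 + e" using \<open>e > 0\<close> \<open>0 \<le> t\<close> by (simp add: field_simps)
    finally show "\<phi> t \<le> \<phi> 0 + e" .
  qed
  then have "exp (\<Lambda> * t) * \<phi> t \<le> exp (\<Lambda> * t) * \<phi> 0" by (intro mult_left_mono) auto
  then show ?thesis by (simp add: \<phi>_def flip: exp_add mult.assoc)
qed

lemma solution_speed:
  assumes "C\<^sub>0 < C"
    and sol: "\<And>u. u \<in> closed_segment 0 t \<Longrightarrow> solves_at X \<sigma> u"
    and stay: "\<And>u. u \<in> closed_segment 0 t \<Longrightarrow> dist (\<sigma> u) (\<sigma> 0) \<le> C * \<bar>u\<bar> \<Longrightarrow> \<sigma> u \<in> S"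
  shows "dist (\<sigma> t) (\<sigma> 0) \<le> C * \<bar>t\<bar>"
proof (cases "0 \<le> t")
  case True
  then show ?thesis
    using speed_forward[of t C \<sigma>] assms by (auto simp: closed_segment_eq_real_ivl)
next
  case False
  interpret rev: arc_region "\<lambda>x h. X x (- h)" S C\<^sub>0 \<Lambda> \<delta> by (rule reverse)
  have "dist (\<sigma> (- (- t))) (\<sigma> (- 0)) \<le> C * (- t)"
  proof (rule rev.speed_forward)
    fix u assume "0 \<le> u" "u \<le> - t"
    then show "solves_at (\<lambda>x h. X x (- h)) (\<lambda>u. \<sigma> (- u)) u"
      using False by (intro solves_at_reverse sol) (auto simp: closed_segment_eq_real_ivl)
  next
    fix u assume "0 \<le> u" "u < - t" "dist (\<sigma> (- u)) (\<sigma> (- 0)) \<le> C * u"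
    then show "\<sigma> (- u) \<in> S"
      using False by (intro stay) (auto simp: closed_segment_eq_real_ivl)
  qed (use False assms in auto)
  then show ?thesis using False by simp
qed

lemma solution_spread:
  assumes sol: "\<And>u. u \<in> closed_segment 0 t \<Longrightarrow>
      solves_at X \<sigma> u \<and> solves_at X \<tau> u \<and> \<sigma> u \<in> S \<and> \<tau> u \<in> S"
  shows "dist (\<sigma> t) (\<tau> t) \<le> exp (\<Lambda> * \<bar>t\<bar>) * dist (\<sigma> 0) (\<tau> 0)"
proof (cases "0 \<le> t")
  case True
  then show ?thesis
    using spread_forward[of t \<sigma> \<tau>] sol by (auto simp: closed_segment_eq_real_ivl)
next
  case False
  interpret rev: arc_region "\<lambda>x h. X x (- h)" S C\<^sub>0 \<Lambda> \<delta> by (rule reverse)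
  have "dist (\<sigma> (- (- t))) (\<tau> (- (- t))) \<le> exp (\<Lambda> * (- t)) * dist (\<sigma> (- 0)) (\<tau> (- 0))"
  proof (rule rev.spread_forward)
    fix u assume "0 \<le> u" "u \<le> - t"
    then show "solves_at (\<lambda>x h. X x (- h)) (\<lambda>u. \<sigma> (- u)) u \<and>
        solves_at (\<lambda>x h. X x (- h)) (\<lambda>u. \<tau> (- u)) u \<and> \<sigma> (- u) \<in> S \<and> \<tau> (- u) \<in> S"
      using False sol[of "- u"] by (auto simp: closed_segment_eq_real_ivl intro!: solves_at_reverse)
  qed (use False in auto)
  then show ?thesis using False by simp
qed

end

section \<open>Existence time of maximal solutions\<close>
lemma arc_field_speed:
  assumes "arc_field X" "arc_speed X y \<le> ereal C" "\<bar>h\<bar> \<le> 1"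
  shows "dist (X y h) y \<le> C * \<bar>h\<bar>"
proof (cases "h = 0")
  case True
  then show ?thesis using assms(1) by (simp add: arc_field_def)
next
  case False
  have "ereal (dist (X y h) (X y 0) / \<bar>h - 0\<bar>) \<le> arc_speed X y"
    unfolding arc_speed_def using False assms(3)
    by (intro SUP_upper2[of "(h, 0)"]) (auto simp: abs_le_iff)
  then have "ereal (dist (X y h) y / \<bar>h\<bar>) \<le> ereal C"
    using assms(1,2) order_trans by (fastforce simp: arc_field_def)
  then show ?thesis using False by (simp add: pos_divide_le_eq)
qed

lemma arc_field_start:
  assumes "arc_field X"
  shows "(X y \<longlongrightarrow> y) (at 0)"
proof -
  have "continuous_on (UNIV \<times> {-1..1}) (\<lambda>(x, t). X x t)" using assms by (simp add: arc_field_def)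
  then have "continuous_on {-1..1} (\<lambda>t. (\<lambda>(x, t). X x t) (y, t))"
    by (rule continuous_on_compose2) (auto intro!: continuous_intros)
  then have "continuous_on {-1..1} (X y)" by simp
  then have "isCont (X y) 0" by (rule continuous_on_interior) simp
  then show ?thesis using assms by (simp add: isCont_def arc_field_def)
qed

lemma arc_field_region:
  assumes "arc_field X" "cond_E1 X"
  shows "\<exists>R>0. \<exists>C\<^sub>0 \<Lambda> \<delta>. arc_region X (ball x\<^sub>0 R) C\<^sub>0 \<Lambda> \<delta>"
proof -
  obtain r1 C\<^sub>0 where r1: "r1 > 0" "\<And>x. x \<in> ball x\<^sub>0 r1 \<Longrightarrow> arc_speed X x \<le> ereal C\<^sub>0"
    using assms(1) unfolding arc_field_def by meson
  obtain r2 \<delta> \<Lambda> where r2: "r2 > 0" "\<delta> > 0" "\<Lambda> > 0" and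
    spread: "\<And>x y t. x \<in> ball x\<^sub>0 r2 \<Longrightarrow> y \<in> ball x\<^sub>0 r2 \<Longrightarrow> \<bar>t\<bar> < \<delta> \<Longrightarrow>
        dist (X x t) (X y t) \<le> dist x y * (1 + \<bar>t\<bar> * \<Lambda>)"
    using assms(2) unfolding cond_E1_def by metis
  have "arc_region X (ball x\<^sub>0 (min r1 r2)) C\<^sub>0 \<Lambda> (min \<delta> 1)"
  proof
    show "(X y \<longlongrightarrow> y) (at 0)" for y by (rule arc_field_start[OF assms(1)])
    show "dist (X y h) y \<le> C\<^sub>0 * \<bar>h\<bar>" if "y \<in> ball x\<^sub>0 (min r1 r2)" "\<bar>h\<bar> < min \<delta> 1" for y h
      using that r1(2)[of y] by (intro arc_field_speed[OF assms(1)]) auto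
  qed (use r1(1) r2 spread in auto)
  then show ?thesis using r1(1) r2(1) by (intro exI[of _ "min r1 r2"]) auto
qed

lemma arc_region_subset:
  assumes "arc_region X S C\<^sub>0 \<Lambda> \<delta>" "S' \<subseteq> S"
  shows "arc_region X S' C\<^sub>0 \<Lambda> \<delta>"
proof -
  interpret arc_region X S C\<^sub>0 \<Lambda> \<delta> by fact
  show ?thesis
    using \<delta>_pos \<Lambda>_nonneg start speed spread assms(2) by unfold_locales (auto simp: subset_iff)
qed

text \<open>
  Continuity is automatic for curves that solve the arc field at each time.
\<close>
lemma (in arc_region) solution_curve_iff:
  "solution_curve X \<alpha> \<beta> \<sigma> \<longleftrightarrow> \<alpha> < \<beta> \<and> (\<forall>t\<in>einterval \<alpha> \<beta>. solves_at X \<sigma> t)"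
proof -
  have "continuous_on (einterval \<alpha> \<beta>) \<sigma>" if "\<forall>t\<in>einterval \<alpha> \<beta>. solves_at X \<sigma> t"
    using that solves_at_isCont by (intro continuous_at_imp_continuous_on) auto
  then show ?thesis unfolding solution_curve_def solves_at_def by blast
qed

lemma maximal_solution_reverse:
  assumes reg: "arc_region X S C\<^sub>0 \<Lambda> \<delta>" and max: "maximal_solution X x \<alpha> \<beta> \<sigma>"
  shows "maximal_solution (\<lambda>x h. X x (- h)) x (- \<beta>) (- \<alpha>) (\<lambda>u. \<sigma> (- u))"
proof -
  interpret arc_region X S C\<^sub>0 \<Lambda> \<delta> by (fact reg)
  interpret rev: arc_region "\<lambda>x h. X x (- h)" S C\<^sub>0 \<Lambda> \<delta> by (rule reverse)
  have mem: "t \<in> einterval (- b) (- a) \<longleftrightarrow> - t \<in> einterval a b" for t a b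
    by (cases a; cases b) (auto simp: einterval_iff)
  have sol: "solution_curve X \<alpha> \<beta> \<sigma>" and x: "0 \<in> einterval \<alpha> \<beta>" "\<sigma> 0 = x"
    and ext: "\<And>\<alpha>' \<beta>' \<sigma>'. solution_curve X \<alpha>' \<beta>' \<sigma>' \<Longrightarrow> einterval \<alpha> \<beta> \<subseteq> einterval \<alpha>' \<beta>' \<Longrightarrow>
        (\<And>t. t \<in> einterval \<alpha> \<beta> \<Longrightarrow> \<sigma>' t = \<sigma> t) \<Longrightarrow> \<alpha>' = \<alpha> \<and> \<beta>' = \<beta>"
    using max unfolding maximal_solution_def by auto
  have "solution_curve (\<lambda>x h. X x (- h)) (- \<beta>) (- \<alpha>) (\<lambda>u. \<sigma> (- u))"
    using sol unfolding solution_curve_iff rev.solution_curve_iff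
    by (auto simp: mem intro!: solves_at_reverse)
  moreover have "0 \<in> einterval (- \<beta>) (- \<alpha>)" using x(1) mem[of 0] by simp
  moreover have "\<alpha>' = - \<beta> \<and> \<beta>' = - \<alpha>"
    if s: "solution_curve (\<lambda>x h. X x (- h)) \<alpha>' \<beta>' \<sigma>'"
      and sub: "einterval (- \<beta>) (- \<alpha>) \<subseteq> einterval \<alpha>' \<beta>'"
      and eq: "\<And>t. t \<in> einterval (- \<beta>) (- \<alpha>) \<Longrightarrow> \<sigma>' t = \<sigma> (- t)" for \<alpha>' \<beta>' \<sigma>'
  proof -
    have mem': "t \<in> einterval (- \<beta>') (- \<alpha>') \<longleftrightarrow> - t \<in> einterval \<alpha>' \<beta>'" for t by (rule mem)
    have "solves_at X (\<lambda>u. \<sigma>' (- u)) t" if "t \<in> einterval (- \<beta>') (- \<alpha>')" for t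
    proof -
      have "solves_at (\<lambda>x h. X x (- h)) \<sigma>' (- t)"
        using s that by (auto simp: rev.solution_curve_iff mem')
      from solves_at_reverse[OF this] show ?thesis by simp
    qed
    then have "solution_curve X (- \<beta>') (- \<alpha>') (\<lambda>u. \<sigma>' (- u))"
      using s by (auto simp: solution_curve_iff rev.solution_curve_iff)
    moreover have "einterval \<alpha> \<beta> \<subseteq> einterval (- \<beta>') (- \<alpha>')"
      using sub mem[of "- t" \<beta> \<alpha> for t] mem' by fastforce
    moreover have "\<sigma>' (- t) = \<sigma> t" if "t \<in> einterval \<alpha> \<beta>" for t
      using eq[of "- t"] that by (simp add: mem)
    ultimately have "- \<beta>' = \<alpha> \<and> - \<alpha>' = \<beta>" by (rule ext)
    then show ?thesis by auto
  qed
  ultimately show ?thesis using x(2) unfolding maximal_solution_def by auto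
qed

text \<open>
  If \<open>\<beta> < T\<close>, the solution is Lipschitz with constant \<open>C\<close> up to the finite time \<open>\<beta>\<close> and stays in
  the ball, so it has a limit \<open>p\<close> there. Its extension by the solution \<open>\<tau>\<close> through \<open>p\<close> must
  follow the arc field at \<open>\<beta>\<close> also towards the left. This holds because \<open>\<tau>\<close> and the given solution agree
  shortly before \<open>\<beta>\<close>: going backwards from times approaching \<open>\<beta>\<close>, where their distance tends to
  \<open>0\<close>, Gronwall's inequality leaves no room between them. The extension contradicts maximality.
\<close>
lemma (in arc_region) lifetime_forward:
  assumes S: "S = ball x\<^sub>0 (2 * R)" and U: "S \<subseteq> U" "complete U"
    and arcs: "\<And>p. \<exists>a>0. \<exists>\<tau>. \<tau> 0 = p \<and> (\<forall>u. \<bar>u\<bar> < a \<longrightarrow> solves_at X \<tau> u)"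
    and C: "C\<^sub>0 < C" "0 \<le> C" and T: "C * T < R"
    and x: "x \<in> ball x\<^sub>0 R" and max: "maximal_solution X x \<alpha> \<beta> \<sigma>"
  shows "ereal T \<le> \<beta>"
proof (rule ccontr)
  assume "\<not> ereal T \<le> \<beta>"
  moreover have zero: "\<alpha> < 0" "0 < \<beta>" "\<sigma> 0 = x"
    using max by (auto simp: maximal_solution_def einterval_iff zero_ereal_def)
  ultimately obtain b where \<beta>: "\<beta> = ereal b" and b: "0 < b" "b < T" by (cases \<beta>) auto
  have Cb: "C * t < R" if "t \<le> b" for t
    using that mult_left_mono[of t T C] b C T by simp
  have sol: "solves_at X \<sigma> t" if "\<alpha> < ereal t" "t < b" for t
    using max that by (auto simp: maximal_solution_def solution_curve_iff einterval_iff \<beta>)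
  have \<alpha>: "\<alpha> < ereal t" if "0 \<le> t" for t
    using zero(1) that by (meson ereal_less_eq(5) less_le_trans)
  have near: "\<sigma> t \<in> S" if t: "0 \<le> t" "t < b" for t
  proof -
    have *: "\<sigma> u \<in> S" if "dist (\<sigma> u) (\<sigma> 0) \<le> C * \<bar>u\<bar>" "\<bar>u\<bar> \<le> b" for u
    proof -
      have "dist x\<^sub>0 (\<sigma> u) \<le> dist x\<^sub>0 x + dist (\<sigma> u) (\<sigma> 0)" unfolding zero(3) by metric
      then show ?thesis using that Cb[of "\<bar>u\<bar>"] x by (simp add: S)
    qed
    have "dist (\<sigma> t) (\<sigma> 0) \<le> C * \<bar>t\<bar>"
    proof (rule solution_speed[OF C(1)])
      fix u assume "u \<in> closed_segment 0 t"
      then have u: "0 \<le> u" "u \<le> t" using t by (auto simp: closed_segment_eq_real_ivl)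
      then show "solves_at X \<sigma> u" using t \<alpha> by (intro sol) auto
      show "\<sigma> u \<in> S" if "dist (\<sigma> u) (\<sigma> 0) \<le> C * \<bar>u\<bar>" using * that u t by simp
    qed
    then show ?thesis using * t by simp
  qed
  have lip_le: "dist (\<sigma> t) (\<sigma> s) \<le> C * \<bar>t - s\<bar>" if "0 \<le> s" "s \<le> t" "t < b" for s t
    using solution_speed[OF C(1), of "t - s" "\<lambda>u. \<sigma> (s + u)"] that sol \<alpha> near
    by (auto simp: solves_at_shift closed_segment_eq_real_ivl)
  have lip: "dist (\<sigma> t) (\<sigma> s) \<le> C * \<bar>t - s\<bar>" if "0 \<le> s" "s < b" "0 \<le> t" "t < b" for s t
    using lip_le[of s t] lip_le[of t s] that by (cases "s \<le> t") (auto simp: dist_commute abs_minus_commute)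
  \<comment> \<open>Any sequence of times in the interval converging to its end point would do.\<close>
  define t where "t n = b * (1 - inverse (real (Suc n)))" for n
  have t: "0 \<le> t n" "t n < b" for n using b(1) by (auto simp: t_def field_simps)
  have t_lim: "t \<longlonglongrightarrow> b"
  proof -
    have "t \<longlonglongrightarrow> b * (1 - 0)"
      unfolding t_def by (intro tendsto_intros LIMSEQ_inverse_real_of_nat)
    then show ?thesis by simp
  qed
  have "Cauchy (\<lambda>n. \<sigma> (t n))"
  proof (rule metric_CauchyI)
    fix e :: real assume "e > 0"
    then have "e / (C + 1) > 0" using C(2) by simp
    then obtain M where M: "\<And>m n. m \<ge> M \<Longrightarrow> n \<ge> M \<Longrightarrow> \<bar>t m - t n\<bar> < e / (C + 1)"
      using LIMSEQ_imp_Cauchy[OF t_lim] unfolding Cauchy_def dist_real_def by metis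
    have "dist (\<sigma> (t m)) (\<sigma> (t n)) < e" if "m \<ge> M" "n \<ge> M" for m n
    proof -
      have "dist (\<sigma> (t m)) (\<sigma> (t n)) \<le> C * \<bar>t m - t n\<bar>" using t by (intro lip) auto
      also have "\<dots> \<le> C * (e / (C + 1))" using M[OF that] C(2) by (intro mult_left_mono) auto
      also have "\<dots> < e" using C(2) \<open>e > 0\<close> by (simp add: field_simps)
      finally show ?thesis .
    qed
    then show "\<exists>M. \<forall>m\<ge>M. \<forall>n\<ge>M. dist (\<sigma> (t m)) (\<sigma> (t n)) < e" by blast
  qed
  moreover have "\<sigma> (t n) \<in> U" for n using near t U(1) by blast
  ultimately obtain p where p: "(\<lambda>n. \<sigma> (t n)) \<longlonglongrightarrow> p"
    by (metis completeE[OF U(2), of "\<lambda>n. \<sigma> (t n)"])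
  have lim: "dist (\<sigma> s) p \<le> C * (b - s)" if "0 \<le> s" "s < b" for s
  proof -
    have "(\<lambda>n. C * \<bar>s - t n\<bar>) \<longlonglongrightarrow> C * \<bar>s - b\<bar>" by (intro tendsto_intros t_lim)
    moreover have "(\<lambda>n. dist (\<sigma> s) (\<sigma> (t n))) \<longlonglongrightarrow> dist (\<sigma> s) p" by (intro tendsto_intros p)
    ultimately have "dist (\<sigma> s) p \<le> C * \<bar>s - b\<bar>"
      using that t by (rule_tac LIMSEQ_le) (auto intro!: lip exI[of _ 0])
    then show ?thesis using that by simp
  qed
  have "dist x\<^sub>0 p \<le> dist x\<^sub>0 x + dist (\<sigma> 0) p" unfolding zero(3) by metric
  then have pS: "p \<in> S" using lim[of 0] b Cb[of b] x by (simp add: S)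
  obtain a\<^sub>0 \<tau> where "a\<^sub>0 > 0" and \<tau>: "\<tau> 0 = p" "\<And>u. \<bar>u\<bar> < a\<^sub>0 \<Longrightarrow> solves_at X \<tau> u"
    using arcs by blast
  have "isCont \<tau> 0" using \<tau>(2) \<open>a\<^sub>0 > 0\<close> by (intro solves_at_isCont) simp
  then have \<tau>_lim: "(\<tau> \<longlongrightarrow> p) (at 0)" by (simp add: isCont_def \<tau>(1))
  then have "\<forall>\<^sub>F u in at 0. \<tau> u \<in> S"
    using pS unfolding S by (intro topological_tendstoD) auto
  then obtain d where "d > 0" and d: "\<And>u. \<bar>u\<bar> < d \<Longrightarrow> \<tau> u \<in> S"
    using pS \<tau>(1) unfolding eventually_at by (metis dist_real_def diff_zero UNIV_I)
  define a where "a = min (min a\<^sub>0 d) b"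
  have a: "0 < a" "a \<le> a\<^sub>0" "a \<le> d" "a \<le> b"
    using \<open>a\<^sub>0 > 0\<close> \<open>d > 0\<close> b by (auto simp: a_def)
  \<comment> \<open>Backward Gronwall from a time \<open>v\<close> close to \<open>b\<close>, where the curves are close.\<close>
  have agree: "\<tau> (s - b) = \<sigma> s" if s: "b - a < s" "s < b" for s
  proof -
    have "dist (\<sigma> s) (\<tau> (s - b)) \<le> exp (\<Lambda> * a) * (C * (b - v) + dist p (\<tau> (v - b)))"
      if v: "v \<in> {s<..<b}" for v
    proof -
      have "dist (\<sigma> (v + (s - v))) (\<tau> (v - b + (s - v))) \<le>
          exp (\<Lambda> * \<bar>s - v\<bar>) * dist (\<sigma> (v + 0)) (\<tau> (v - b + 0))"
        using s v a \<alpha> by (intro solution_spread)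
          (auto simp: solves_at_shift closed_segment_eq_real_ivl intro!: sol near \<tau>(2) d)
      also have "\<dots> \<le> exp (\<Lambda> * a) * (dist (\<sigma> v) p + dist p (\<tau> (v - b)))"
        using s v \<Lambda>_nonneg by (intro mult_mono) (auto intro!: mult_left_mono dist_triangle)
      also have "\<dots> \<le> exp (\<Lambda> * a) * (C * (b - v) + dist p (\<tau> (v - b)))"
        using s v a by (intro mult_left_mono add_right_mono lim) auto
      finally show ?thesis by simp
    qed
    then have "\<forall>\<^sub>F v in at_left b.
        dist (\<sigma> s) (\<tau> (s - b)) \<le> exp (\<Lambda> * a) * (C * (b - v) + dist p (\<tau> (v - b)))"
      using eventually_at_left_real[OF s(2)] by (rule eventually_mono[rotated])
    moreover have "((\<lambda>v. \<tau> (v - b)) \<longlongrightarrow> p) (at_left b)"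
      by (rule tendsto_compose_eventually[OF \<tau>_lim])
        (auto intro!: tendsto_eq_intros simp: eventually_at_filter)
    then have "((\<lambda>v. exp (\<Lambda> * a) * (C * (b - v) + dist p (\<tau> (v - b)))) \<longlongrightarrow>
        exp (\<Lambda> * a) * (C * (b - b) + dist p p)) (at_left b)"
      by (intro tendsto_intros)
    ultimately have "dist (\<sigma> s) (\<tau> (s - b)) \<le> exp (\<Lambda> * a) * (C * (b - b) + dist p p)"
      by (rule_tac tendsto_lowerbound) auto
    then show ?thesis by simp
  qed
  define \<rho> where "\<rho> s = (if s < b then \<sigma> s else \<tau> (s - b))" for s
  have \<rho>: "solves_at X \<rho> s" if "\<alpha> < ereal s" "s < b + a" for s
  proof (cases "s < b")
    case True
    show ?thesis
      using sol[OF that(1) True] by (rule solves_at_cong[of _ _ _ "{..<b}"]) (auto simp: \<rho>_def True)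
  next
    case False
    have "solves_at X (\<lambda>u. \<tau> (- b + u)) s"
      unfolding solves_at_shift using False that a by (intro \<tau>(2)) auto
    then show ?thesis
    proof (rule solves_at_cong)
      show "\<rho> u = \<tau> (- b + u)" if "u \<in> {b - a<..}" for u
        using that agree[of u] by (simp add: \<rho>_def)
    qed (use False a in auto)
  qed
  have "\<alpha> = \<alpha> \<and> ereal (b + a) = \<beta>"
  proof -
    have "solution_curve X \<alpha> (ereal (b + a)) \<rho>"
      using \<rho> \<alpha>[of "b + a"] a b by (auto simp: solution_curve_iff einterval_iff)
    moreover have "einterval \<alpha> \<beta> \<subseteq> einterval \<alpha> (ereal (b + a))"
      using a by (auto simp: einterval_iff \<beta>)
    moreover have "\<forall>s\<in>einterval \<alpha> \<beta>. \<rho> s = \<sigma> s" by (auto simp: \<rho>_def \<beta> einterval_iff)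
    ultimately show ?thesis using max unfolding maximal_solution_def by blast
  qed
  then show False using a by (simp add: \<beta>)
qed

section \<open>Flow boxes\<close>

text \<open>
  The interface between the theory of solutions and the commutation argument: everything needed
  about a flow near a point, for times below \<open>T\<close>.
\<close>
locale flow_box =
  fixes F :: "'a::metric_space \<Rightarrow> real \<Rightarrow> 'a" and B :: "'a set" and T C L :: real
  assumes T_pos: "0 < T" and C_nonneg: "0 \<le> C" and L_ge_1: "1 \<le> L"
    and flow_zero: "x \<in> B \<Longrightarrow> F x 0 = x"
    and lipschitz_time: "x \<in> B \<Longrightarrow> \<bar>s\<bar> < T \<Longrightarrow> \<bar>t\<bar> < T \<Longrightarrow> dist (F x s) (F x t) \<le> C * \<bar>s - t\<bar>"
    and lipschitz_space: "x \<in> B \<Longrightarrow> y \<in> B \<Longrightarrow> \<bar>t\<bar> < T \<Longrightarrow> dist (F x t) (F y t) \<le> L * dist x y"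
    and flow_add: "x \<in> B \<Longrightarrow> F x s \<in> B \<Longrightarrow> \<bar>s\<bar> < T \<Longrightarrow> \<bar>t\<bar> < T \<Longrightarrow> \<bar>s + t\<bar> < T \<Longrightarrow>
      F (F x s) t = F x (s + t)"

lemma flow_box_mono:
  assumes "flow_box F B T C L" "B' \<subseteq> B" "0 < T'" "T' \<le> T" "C \<le> C'" "L \<le> L'"
  shows "flow_box F B' T' C' L'"
proof -
  interpret flow_box F B T C L by fact
  show ?thesis
  proof
    show "dist (F x s) (F x t) \<le> C' * \<bar>s - t\<bar>" if "x \<in> B'" "\<bar>s\<bar> < T'" "\<bar>t\<bar> < T'" for x s t
    proof -
      have "dist (F x s) (F x t) \<le> C * \<bar>s - t\<bar>" using that assms by (intro lipschitz_time) auto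
      also have "\<dots> \<le> C' * \<bar>s - t\<bar>" using assms by (intro mult_right_mono) auto
      finally show ?thesis .
    qed
    show "dist (F x t) (F y t) \<le> L' * dist x y" if "x \<in> B'" "y \<in> B'" "\<bar>t\<bar> < T'" for x y t
    proof -
      have "dist (F x t) (F y t) \<le> L * dist x y" using that assms by (intro lipschitz_space) auto
      also have "\<dots> \<le> L' * dist x y" using assms by (intro mult_right_mono) auto
      finally show ?thesis .
    qed
    show "F (F x s) t = F x (s + t)"
      if "x \<in> B'" "F x s \<in> B'" "\<bar>s\<bar> < T'" "\<bar>t\<bar> < T'" "\<bar>s + t\<bar> < T'" for x s t
      using that assms by (intro flow_add) auto
  qed (use assms C_nonneg L_ge_1 flow_zero in auto)
qed

text \<open>
  A local flow uses a maximal solution only on the inner half of its interval, hence the time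
  bound \<open>T / 2\<close>: below it, the constant continuation is not yet reached on either side.
\<close>
lemma local_flow_lifetime:
  assumes reg: "arc_region X (ball x\<^sub>0 (2 * R)) C\<^sub>0 \<Lambda> \<delta>"
    and U: "ball x\<^sub>0 (2 * R) \<subseteq> U" "complete U"
    and flow: "local_flow X F"
    and C: "C\<^sub>0 < C" "0 \<le> C" and T: "C * T < R" "0 < T" "T \<le> 1"
    and x: "x \<in> ball x\<^sub>0 R"
  shows "F x 0 = x" and "\<bar>t\<bar> < T / 2 \<Longrightarrow> solves_at X (F x) t"
proof -
  interpret arc_region X "ball x\<^sub>0 (2 * R)" C\<^sub>0 \<Lambda> \<delta> by (fact reg)
  interpret rev: arc_region "\<lambda>x h. X x (- h)" "ball x\<^sub>0 (2 * R)" C\<^sub>0 \<Lambda> \<delta> by (rule reverse)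
  have arcs: "\<exists>a>0. \<exists>\<tau>. \<tau> 0 = p \<and> (\<forall>u. \<bar>u\<bar> < a \<longrightarrow> solves_at X \<tau> u)" for p
  proof -
    obtain \<alpha> \<beta> \<sigma> where max: "maximal_solution X p \<alpha> \<beta> \<sigma>"
      using flow unfolding local_flow_def by blast
    then have "0 \<in> einterval \<alpha> \<beta>" by (simp add: maximal_solution_def)
    then obtain a where "a > 0" "ball 0 a \<subseteq> einterval \<alpha> \<beta>"
      using open_einterval open_contains_ball by blast
    moreover have "solves_at X \<sigma> u" if "u \<in> einterval \<alpha> \<beta>" for u
      using max that by (simp add: maximal_solution_def solution_curve_iff)
    ultimately have "\<sigma> 0 = p \<and> (\<forall>u. \<bar>u\<bar> < a \<longrightarrow> solves_at X \<sigma> u)"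
      using max by (auto simp: maximal_solution_def subset_iff)
    then show ?thesis using \<open>a > 0\<close> by blast
  qed
  have rev_arcs: "\<exists>a>0. \<exists>\<tau>. \<tau> 0 = p \<and> (\<forall>u. \<bar>u\<bar> < a \<longrightarrow> solves_at (\<lambda>x h. X x (- h)) \<tau> u)" for p
  proof -
    obtain a \<tau> where "a > 0" "\<tau> 0 = p" and sol: "\<And>u. \<bar>u\<bar> < a \<Longrightarrow> solves_at X \<tau> u"
      using arcs by blast
    moreover have "solves_at (\<lambda>x h. X x (- h)) (\<lambda>u. \<tau> (- u)) u" if "\<bar>u\<bar> < a" for u
      using that by (intro solves_at_reverse sol) simp
    ultimately show ?thesis by (intro exI[of _ a] conjI exI[of _ "\<lambda>u. \<tau> (- u)"]) auto
  qed
  obtain \<alpha> \<beta> \<sigma> where max: "maximal_solution X x \<alpha> \<beta> \<sigma>" and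
    F: "\<And>t. t \<in> {-1..1} \<Longrightarrow> F x t =
           (if ereal t \<le> \<alpha> / 2 then \<sigma> (real_of_ereal (\<alpha> / 2))
            else if \<beta> / 2 \<le> ereal t then \<sigma> (real_of_ereal (\<beta> / 2))
            else \<sigma> t)"
    using flow unfolding local_flow_def by blast
  have "ereal T \<le> \<beta>"
    using max arcs by (intro lifetime_forward[OF refl U _ C T(1) x]) auto
  then have \<beta>: "ereal (T / 2) \<le> \<beta> / 2" using ereal_divide_right_mono[of "ereal T" \<beta> 2] by simp
  have "ereal T \<le> - \<alpha>"
    using maximal_solution_reverse[OF reg max] rev_arcs
    by (intro rev.lifetime_forward[OF refl U _ C T(1) x]) auto
  then have "\<alpha> \<le> ereal (- T)" by (cases \<alpha>) auto
  then have \<alpha>: "\<alpha> / 2 \<le> ereal (- T / 2)" using ereal_divide_right_mono[of \<alpha> "ereal (- T)" 2] by simp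
  have F\<sigma>: "F x t = \<sigma> t" if "\<bar>t\<bar> < T / 2" for t
  proof -
    have t: "ereal (- T / 2) < ereal t" "ereal t < ereal (T / 2)" using that by auto
    have "\<not> ereal t \<le> \<alpha> / 2" using le_less_trans[OF \<alpha> t(1)] by (simp add: not_le)
    moreover have "\<not> \<beta> / 2 \<le> ereal t" using less_le_trans[OF t(2) \<beta>] by (simp add: not_le)
    moreover have "- 1 \<le> t" "t \<le> 1" using that T by linarith+
    ultimately show ?thesis using F[of t] by simp
  qed
  then show "F x 0 = x" using max T by (simp add: maximal_solution_def)
  assume t: "\<bar>t\<bar> < T / 2"
  have tT: "ereal (- T) < ereal t" "ereal t < ereal T" using t T(2) by auto
  have "\<alpha> < ereal t" using le_less_trans[OF \<open>\<alpha> \<le> ereal (- T)\<close> tT(1)] .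
  moreover have "ereal t < \<beta>" using less_le_trans[OF tT(2) \<open>ereal T \<le> \<beta>\<close>] .
  ultimately have "solves_at X \<sigma> t"
    using max by (auto simp: maximal_solution_def solution_curve_iff einterval_iff)
  then show "solves_at X (F x) t"
    by (rule solves_at_cong[of _ _ _ "{- T / 2<..<T / 2}"]) (use t F\<sigma> in auto)
qed

text \<open>
  Solutions from \<open>ball x\<^sub>0 R\<close> stay in \<open>ball x\<^sub>0 (2 * R)\<close> for a common time, and there the growth
  estimates apply to them. The group law is the Gronwall estimate for two solutions that start
  at the same point.
\<close>
lemma local_flow_box:
  fixes X F :: "'a::metric_space \<Rightarrow> real \<Rightarrow> 'a"
  assumes "locally_complete TYPE('a)" "arc_field X" "cond_E1 X" "local_flow X F"
  shows "\<exists>R>0. \<exists>T C L. flow_box F (ball x\<^sub>0 R) T C L"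
proof -
  obtain U where "x\<^sub>0 \<in> interior U" "complete U"
    using assms(1) unfolding locally_complete_def by blast
  then obtain R\<^sub>1 where R\<^sub>1: "R\<^sub>1 > 0" "ball x\<^sub>0 R\<^sub>1 \<subseteq> U" by (meson mem_interior)
  obtain R\<^sub>2 C\<^sub>0 \<Lambda> \<delta> where R\<^sub>2: "R\<^sub>2 > 0" "arc_region X (ball x\<^sub>0 R\<^sub>2) C\<^sub>0 \<Lambda> \<delta>"
    using arc_field_region[OF assms(2,3)] by blast
  define R where "R = min R\<^sub>1 R\<^sub>2 / 2"
  define S where "S = ball x\<^sub>0 (2 * R)"
  have R: "R > 0" "ball x\<^sub>0 (2 * R) \<subseteq> U"
    using R\<^sub>1 R\<^sub>2 by (auto simp: R_def min_def subset_iff)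
  have reg: "arc_region X S C\<^sub>0 \<Lambda> \<delta>"
    using R\<^sub>2 by (rule_tac arc_region_subset) (auto simp: R_def S_def)
  interpret arc_region X S C\<^sub>0 \<Lambda> \<delta> by (fact reg)
  define C where "C = max C\<^sub>0 0 + 1"
  have C: "C\<^sub>0 < C" "0 < C" by (auto simp: C_def)
  define T where "T = min 1 (R / (2 * C))"
  have T: "T > 0" "T \<le> 1" using R C by (auto simp: T_def)
  have "C * T \<le> C * (R / (2 * C))" unfolding T_def using C by (intro mult_left_mono) auto
  then have CT: "C * T < R" using C R by simp
  note life = local_flow_lifetime[OF reg[unfolded S_def] R(2) \<open>complete U\<close> assms(4) C(1)
    less_imp_le[OF C(2)] CT T]
  have near: "F x t \<in> S" if x: "x \<in> ball x\<^sub>0 R" and t: "\<bar>t\<bar> < T / 2" for x t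
  proof -
    have *: "F x u \<in> S" if "dist (F x u) (F x 0) \<le> C * \<bar>u\<bar>" "\<bar>u\<bar> \<le> \<bar>t\<bar>" for u
    proof -
      have "dist x\<^sub>0 (F x u) \<le> dist x\<^sub>0 x + dist (F x u) (F x 0)" unfolding life(1)[OF x] by metric
      moreover have "C * \<bar>u\<bar> \<le> C * T" using that t T C by (intro mult_left_mono) auto
      ultimately show ?thesis using that CT x by (simp add: S_def)
    qed
    have seg: "\<bar>u\<bar> \<le> \<bar>t\<bar>" if "u \<in> closed_segment 0 t" for u
      using that by (auto simp: closed_segment_eq_real_ivl split: if_splits)
    have "dist (F x t) (F x 0) \<le> C * \<bar>t\<bar>"
    proof (rule solution_speed[OF C(1)])
      fix u assume "u \<in> closed_segment 0 t"
      from seg[OF this] show "solves_at X (F x) u" using t by (intro life(2)[OF x]) simp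
      show "F x u \<in> S" if "dist (F x u) (F x 0) \<le> C * \<bar>u\<bar>"
        using * that \<open>\<bar>u\<bar> \<le> \<bar>t\<bar>\<close> by blast
    qed
    then show ?thesis using * by simp
  qed
  have seg: "\<bar>s + u\<bar> < T / 2" if "u \<in> closed_segment 0 t" "\<bar>s\<bar> < T / 2" "\<bar>s + t\<bar> < T / 2" for s t u
  proof -
    have "min 0 t \<le> u" "u \<le> max 0 t"
      using that(1) by (auto simp: closed_segment_eq_real_ivl split: if_splits)
    then show ?thesis using that(2,3) by linarith
  qed
  have time: "dist (F x s) (F x t) \<le> C * \<bar>s - t\<bar>"
    if x: "x \<in> ball x\<^sub>0 R" and st: "\<bar>s\<bar> < T / 2" "\<bar>t\<bar> < T / 2" for x s t
  proof -
    have u: "\<bar>t + u\<bar> < T / 2" if "u \<in> closed_segment 0 (s - t)" for u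
      using that st seg[of u "s - t" t] by simp
    have "solves_at X (\<lambda>u. F x (t + u)) u" if "u \<in> closed_segment 0 (s - t)" for u
      using life(2)[OF x u[OF that]] solves_at_shift[of X "F x" t u] by blast
    moreover have "F x (t + u) \<in> S" if "u \<in> closed_segment 0 (s - t)" for u
      using near[OF x u[OF that]] .
    ultimately show ?thesis
      using solution_speed[OF C(1), of "s - t" "\<lambda>u. F x (t + u)"] by simp
  qed
  have space: "dist (F x t) (F y t) \<le> exp (\<Lambda> * (T / 2)) * dist x y"
    if x: "x \<in> ball x\<^sub>0 R" and y: "y \<in> ball x\<^sub>0 R" and t: "\<bar>t\<bar> < T / 2" for x y t
  proof -
    have u: "\<bar>u\<bar> < T / 2" if "u \<in> closed_segment 0 t" for u
      using that t seg[of u t 0] T by simp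
    have "dist (F x t) (F y t) \<le> exp (\<Lambda> * \<bar>t\<bar>) * dist (F x 0) (F y 0)"
      using life(2)[OF x u] life(2)[OF y u] near[OF x u] near[OF y u]
      by (intro solution_spread[of t "F x" "F y"]) blast
    also have "\<Lambda> * \<bar>t\<bar> \<le> \<Lambda> * (T / 2)" using t \<Lambda>_nonneg by (intro mult_left_mono) auto
    then have "exp (\<Lambda> * \<bar>t\<bar>) * dist (F x 0) (F y 0) \<le> exp (\<Lambda> * (T / 2)) * dist x y"
      unfolding life(1)[OF x] life(1)[OF y] by (intro mult_right_mono) auto
    finally show ?thesis .
  qed
  have add: "F (F x s) t = F x (s + t)"
    if x: "x \<in> ball x\<^sub>0 R" and y: "F x s \<in> ball x\<^sub>0 R"
      and st: "\<bar>s\<bar> < T / 2" "\<bar>t\<bar> < T / 2" "\<bar>s + t\<bar> < T / 2" for x s t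
  proof -
    have u: "\<bar>u\<bar> < T / 2" "\<bar>s + u\<bar> < T / 2" if "u \<in> closed_segment 0 t" for u
      using that st seg[of u t 0] seg[of u t s] T by auto
    have "solves_at X (\<lambda>u. F x (s + u)) u" if "u \<in> closed_segment 0 t" for u
      using life(2)[OF x u(2)[OF that]] solves_at_shift[of X "F x" s u] by blast
    then have "dist (F (F x s) t) (F x (s + t)) \<le> exp (\<Lambda> * \<bar>t\<bar>) * dist (F (F x s) 0) (F x (s + 0))"
      using life(2)[OF y u(1)] near[OF y u(1)] near[OF x u(2)]
      by (intro solution_spread[of t "F (F x s)" "\<lambda>u. F x (s + u)"]) blast
    then show ?thesis by (simp add: life(1)[OF y])
  qed
  have "flow_box F (ball x\<^sub>0 R) (T / 2) C (exp (\<Lambda> * (T / 2)))"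
    using T C \<Lambda>_nonneg life(1) time space add by unfold_locales auto
  then show ?thesis using R by blast
qed

section \<open>Commuting flows\<close>

text \<open>
  If a map \<open>Q\<close> commutes with the flow for the short time \<open>h\<close> up to \<open>A\<close> along an orbit, then it
  commutes with it for time \<open>n h\<close> up to \<open>n L A\<close>. The intermediate points apply \<open>Q\<close> after \<open>j\<close> of
  the \<open>n\<close> steps. Neighbours differ by one exchange followed by a single flow map of Lipschitz
  constant \<open>L\<close>, so the constant does not accumulate over the steps.
\<close>
lemma (in flow_box) swap_steps:
  fixes n :: nat
  assumes h: "0 \<le> h" "real n * h < T" and x: "x \<in> B"
    and orbit: "\<And>j. j \<le> n \<Longrightarrow> F x (real j * h) \<in> B \<and> Q (F x (real j * h)) \<in> B"
    and image: "\<And>j. j < n \<Longrightarrow> F (Q (F x (real j * h))) h \<in> B"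
    and swap: "\<And>j. j < n \<Longrightarrow>
      dist (F (Q (F x (real j * h))) h) (Q (F (F x (real j * h)) h)) \<le> A"
  shows "dist (F (Q x) (real n * h)) (Q (F x (real n * h))) \<le> real n * (L * A)"
proof -
  define z where "z j = F (Q (F x (real j * h))) (real (n - j) * h)" for j
  have time: "\<bar>real j * h\<bar> < T" if "j \<le> n" for j
    using that h mult_right_mono[of "real j" "real n" h] by (simp add: abs_mult)
  have step: "dist (z j) (z (Suc j)) \<le> L * A" if j: "j < n" for j
  proof -
    define y where "y = F x (real j * h)"
    have split: "real (n - j) * h = h + real (n - Suc j) * h" "real (Suc j) * h = real j * h + h"
      using j by (auto simp: algebra_simps of_nat_diff)
    have times: "\<bar>h\<bar> < T" "\<bar>real (n - Suc j) * h\<bar> < T" "\<bar>h + real (n - Suc j) * h\<bar> < T"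
        "\<bar>real j * h\<bar> < T" "\<bar>real j * h + h\<bar> < T"
      using time[of 1] time[of "n - Suc j"] time[of "n - j"] time[of j] time[of "Suc j"] j split by auto
    have y: "y \<in> B" "Q y \<in> B" "F (Q y) h \<in> B" using orbit[of j] image[of j] j by (auto simp: y_def)
    have succ: "F y h = F x (real (Suc j) * h)"
      unfolding split y_def using times y x by (intro flow_add) (auto simp: y_def)
    then have Qy: "Q (F y h) \<in> B" using orbit[of "Suc j"] j by simp
    have "z j = F (F (Q y) h) (real (n - Suc j) * h)"
      unfolding z_def split(1) using times y by (subst flow_add) (auto simp: y_def)
    moreover have "z (Suc j) = F (Q (F y h)) (real (n - Suc j) * h)"
      by (simp add: z_def succ)
    ultimately have "dist (z j) (z (Suc j)) \<le> L * dist (F (Q y) h) (Q (F y h))"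
      using times y Qy by (simp add: lipschitz_space)
    also have "\<dots> \<le> L * A" using swap[OF j] L_ge_1 by (intro mult_left_mono) (auto simp: y_def)
    finally show ?thesis .
  qed
  have "dist (z 0) (z j) \<le> real j * (L * A)" if "j \<le> n" for j
    using that
  proof (induction j)
    case (Suc j)
    have "dist (z 0) (z (Suc j)) \<le> dist (z 0) (z j) + dist (z j) (z (Suc j))" by (rule dist_triangle)
    then show ?case using Suc step[of j] by (simp add: algebra_simps)
  qed simp
  from this[of n] show ?thesis
    using x orbit[of n] by (simp add: z_def flow_zero)
qed

text \<open>
  Two flows on a common box. With \<open>C * \<tau> \<le> c\<close> a flow moves points by at most \<open>c\<close> during a time
  below \<open>\<tau>\<close>, so from the ball of radius \<open>k c\<close> it leads into the one of radius \<open>(k + 1) c\<close>. Radius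
  \<open>10 c\<close> leaves room for all compositions of flow maps below, and the time bound \<open>2 * \<tau>\<close> lets two
  times below \<open>\<tau>\<close> be added freely.
\<close>
locale flow_box_pair =
  F: flow_box F "ball x\<^sub>0 (10 * c)" "2 * \<tau>" C L + G: flow_box G "ball x\<^sub>0 (10 * c)" "2 * \<tau>" C L
  for F G :: "'a::metric_space \<Rightarrow> real \<Rightarrow> 'a" and x\<^sub>0 c \<tau> C L +
  assumes c_pos: "0 < c" and step_le: "C * \<tau> \<le> c"
begin

abbreviation D :: "real \<Rightarrow> 'a set" where "D k \<equiv> ball x\<^sub>0 (k * c)"

lemma flip: "flow_box_pair G F x\<^sub>0 c \<tau> C L"
  by unfold_locales (rule c_pos step_le)+

lemma \<tau>_pos: "0 < \<tau>" using F.T_pos by simp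

lemma D_mono: "x \<in> D k \<Longrightarrow> k \<le> m \<Longrightarrow> x \<in> D m"
  using subset_ball[of "k * c" "m * c" x\<^sub>0] mult_right_mono[of k m c] c_pos by fastforce

lemma F_move:
  assumes "x \<in> D k" "k + 1 \<le> m" "m \<le> 10" "\<bar>t\<bar> < \<tau>"
  shows "F x t \<in> D m"
proof -
  have x: "x \<in> D 10" using assms(2,3) by (intro D_mono[OF assms(1)]) simp
  have "dist (F x 0) (F x t) \<le> C * \<bar>0 - t\<bar>"
    using assms(4) \<tau>_pos by (intro F.lipschitz_time x) auto
  also have "\<dots> \<le> C * \<tau>" using assms(4) F.C_nonneg by (intro mult_left_mono) auto
  finally have "dist x (F x t) \<le> c" using F.flow_zero[OF x] step_le by simp
  moreover have "dist x\<^sub>0 (F x t) \<le> dist x\<^sub>0 x + dist x (F x t)" by (rule dist_triangle)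
  ultimately have "F x t \<in> D (k + 1)" using assms(1) by (simp add: algebra_simps)
  then show ?thesis using assms(2) by (rule D_mono)
qed

lemma F_add:
  assumes "x \<in> D 9" "\<bar>s\<bar> < \<tau>" "\<bar>t\<bar> < \<tau>"
  shows "F (F x s) t = F x (s + t)"
  using assms(2,3) D_mono[OF assms(1)] F_move[OF assms(1)] by (intro F.flow_add) auto

lemma F_cancel: "x \<in> D 9 \<Longrightarrow> \<bar>s\<bar> < \<tau> \<Longrightarrow> F (F x s) (- s) = x"
  using F_add[of x s "- s"] F.flow_zero[OF D_mono[of x 9 10]] by simp

lemma F_cancel': "x \<in> D 9 \<Longrightarrow> \<bar>s\<bar> < \<tau> \<Longrightarrow> F (F x (- s)) s = x"
  using F_cancel[of x "- s"] by simp

end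

text \<open>
  The roles of the flows are interchangeable, so each fact about \<open>F\<close> is also one about \<open>G\<close>.
\<close>
sublocale flow_box_pair \<subseteq> flip: flow_box_pair G F x\<^sub>0 c \<tau> C L
  by (rule flip)

context flow_box_pair
begin

lemmas G_move = flip.F_move and G_add = flip.F_add and G_cancel = flip.F_cancel
  and G_cancel' = flip.F_cancel'

lemma commute_iff_pullback:
  assumes "x \<in> D 1" "\<bar>s\<bar> < \<tau>" "\<bar>t\<bar> < \<tau>"
  shows "F (G x s) t = G (F x t) s \<longleftrightarrow> arc_pullback F t G x s = G x s"
proof -
  have "G (F x t) s \<in> D 9" "G x s \<in> D 9"
    using assms(2,3) G_move[OF F_move[OF assms(1), of 2]] G_move[OF assms(1)] by auto
  then show ?thesis
    using F_cancel[of "G x s" t] F_cancel'[of "G (F x t) s" t] assms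
    unfolding arc_pullback_def by metis
qed

lemma commute_imp_bracket_trivial:
  assumes x: "x \<in> D 1" and t: "sqrt \<bar>t\<bar> < \<tau>"
    and commute: "F (G x (sqrt \<bar>t\<bar>)) (sqrt \<bar>t\<bar>) = G (F x (sqrt \<bar>t\<bar>)) (sqrt \<bar>t\<bar>)"
  shows "arc_bracket F G x t = x"
proof -
  have "F x (sqrt \<bar>t\<bar>) \<in> D 9" "G x (sqrt \<bar>t\<bar>) \<in> D 9" "x \<in> D 9"
    using t F_move[OF x] G_move[OF x] D_mono[OF x] by auto
  then show ?thesis
    using t commute F_cancel[of x "sqrt \<bar>t\<bar>"] G_cancel[of x "sqrt \<bar>t\<bar>"]
      F_cancel[of "G x (sqrt \<bar>t\<bar>)" "sqrt \<bar>t\<bar>"] G_cancel[of "F x (sqrt \<bar>t\<bar>)" "sqrt \<bar>t\<bar>"]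
    by (auto simp: arc_bracket_def)
qed

text \<open>
  With \<open>w\<close> the bracket at \<open>y\<close>, undoing its last two steps gives \<open>F\<^sub>h G\<^sub>h w = G\<^sub>h F\<^sub>h y\<close>, and
  \<open>F\<^sub>h G\<^sub>h\<close> has Lipschitz constant \<open>L\<^sup>2\<close>.
\<close>
lemma bracket_bounds_swap:
  assumes y: "y \<in> D 5" and h: "0 \<le> h" "h < \<tau>"
  shows "dist (G (F y h) h) (F (G y h) h) \<le> L * (L * dist (arc_bracket F G y (h\<^sup>2)) y)"
proof -
  define z w where "z = G (F y h) h" and "w = G (F z (- h)) (- h)"
  have w: "arc_bracket F G y (h\<^sup>2) = w"
    using h by (simp add: arc_bracket_def w_def z_def)
  have z: "z \<in> D 7" unfolding z_def using h by (intro G_move[OF F_move[OF y, of 6]]) auto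
  then have z': "F z (- h) \<in> D 8" using h by (intro F_move[of _ 7]) auto
  have wD: "w \<in> D 9" unfolding w_def using z' h by (intro G_move[of _ 8]) auto
  have "G w h = F z (- h)"
    unfolding w_def using h by (intro G_cancel' D_mono[OF z']) auto
  moreover have "F (F z (- h)) h = z" using h by (intro F_cancel' D_mono[OF z]) auto
  ultimately have "dist z (F (G y h) h) = dist (F (G w h) h) (F (G y h) h)" by simp
  also have "\<dots> \<le> L * dist (G w h) (G y h)"
    using h by (intro F.lipschitz_space G_move[OF wD] G_move[OF y]) auto
  also have "\<dots> \<le> L * (L * dist w y)"
    using h F.L_ge_1 by (intro mult_left_mono G.lipschitz_space D_mono[OF wD] D_mono[OF y]) auto
  finally show ?thesis by (simp add: z_def w)
qed

text \<open>
  Exchanging first \<open>F\<^sub>h\<close> with the \<open>q\<close> steps of \<open>G\<close> crosses one column of \<open>q\<close> squares;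
  exchanging the resulting map \<open>G\<^bsub>qh\<^esub>\<close> with the \<open>p\<close> steps of \<open>F\<close> crosses the \<open>p\<close> columns.
  Of the four factors \<open>L\<close>, two come from the bracket and one from each application of
  \<open>swap_steps\<close>.
\<close>
lemma grid_swap:
  fixes p q :: nat
  assumes x: "x \<in> D 3" and h: "0 \<le> h" "h < \<tau>" "real p * h < \<tau>" "real q * h < \<tau>"
    and A: "\<And>y. y \<in> D 5 \<Longrightarrow> dist (arc_bracket F G y (h\<^sup>2)) y \<le> A"
  shows "dist (F (G x (real q * h)) (real p * h)) (G (F x (real p * h)) (real q * h))
    \<le> real p * real q * L ^ 4 * A"
proof -
  have time: "\<bar>real j * h\<bar> < \<tau>" if "j \<le> p \<or> j \<le> q" for j
    using that h mult_right_mono[of "real j" "real p" h] mult_right_mono[of "real j" "real q" h]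
    by (auto simp: abs_mult)
  have column: "dist (F (G y (real q * h)) h) (G (F y h) (real q * h)) \<le> real q * (L * (L * (L * A)))"
    if y: "y \<in> D 4" for y
  proof -
    have "dist (G (F y h) (real q * h)) (F (G y (real q * h)) h) \<le> real q * (L * (L * (L * A)))"
    proof (rule G.swap_steps)
      show "real q * h < 2 * \<tau>" using h \<tau>_pos by simp
      show "y \<in> D 10" by (rule D_mono[OF y]) simp
      fix j
      show "G y (real j * h) \<in> D 10 \<and> F (G y (real j * h)) h \<in> D 10" if "j \<le> q"
        using h time[of j] that by (intro conjI F_move[OF G_move[OF y, of 5]] G_move[OF y]) auto
      assume "j < q"
      then have yj: "G y (real j * h) \<in> D 5" using y time[of j] by (intro G_move[of _ 4]) auto
      then show "G (F (G y (real j * h)) h) h \<in> D 10"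
        using h by (intro G_move[OF F_move[OF yj, of 6]]) auto
      have "dist (G (F (G y (real j * h)) h) h) (F (G (G y (real j * h)) h) h)
          \<le> L * (L * dist (arc_bracket F G (G y (real j * h)) (h\<^sup>2)) (G y (real j * h)))"
        using yj h by (intro bracket_bounds_swap) auto
      also have "\<dots> \<le> L * (L * A)"
        using A[OF yj] F.L_ge_1 by (intro mult_left_mono) auto
      finally show "dist (G (F (G y (real j * h)) h) h) (F (G (G y (real j * h)) h) h) \<le> L * (L * A)" .
    qed (use h in auto)
    then show ?thesis by (simp add: dist_commute)
  qed
  have "dist (F (G x (real q * h)) (real p * h)) (G (F x (real p * h)) (real q * h))
      \<le> real p * (L * (real q * (L * (L * (L * A)))))"
  proof (rule F.swap_steps)
    show "real p * h < 2 * \<tau>" using h \<tau>_pos by simp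
    show "x \<in> D 10" by (rule D_mono[OF x]) simp
    fix j
    show "F x (real j * h) \<in> D 10 \<and> G (F x (real j * h)) (real q * h) \<in> D 10" if "j \<le> p"
      using h time[of j] time[of q] that by (intro conjI G_move[OF F_move[OF x, of 4]] F_move[OF x]) auto
    assume "j < p"
    then have xj: "F x (real j * h) \<in> D 4" using x time[of j] by (intro F_move[of _ 3]) auto
    then show "F (G (F x (real j * h)) (real q * h)) h \<in> D 10"
      using h time[of q] by (intro F_move[OF G_move[OF xj, of 5]]) auto
    show "dist (F (G (F x (real j * h)) (real q * h)) h) (G (F (F x (real j * h)) h) (real q * h))
        \<le> real q * (L * (L * (L * A)))"
      using column[OF xj] .
  qed (use h in auto)
  then show ?thesis by (simp add: power_def numeral_eq_Suc algebra_simps)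
qed

text \<open>
  The times \<open>s\<close> and \<open>t\<close> are rounded down to multiples of \<open>h\<close>, at the cost of \<open>O(h)\<close>, and the grid
  of at most \<open>s t / h\<^sup>2\<close> squares costs \<open>O(\<eta>)\<close> if the bracket is at most \<open>\<eta> h\<^sup>2\<close>. The two
  parameters are sent to \<open>0\<close> one after the other, because the admissible \<open>h\<close> depend on \<open>\<eta>\<close>.
\<close>
lemma small_bracket_imp_commute_nonneg:
  assumes bracket: "\<And>\<eta>. \<eta> > 0 \<Longrightarrow>
      \<exists>\<delta>>0. \<forall>y\<in>D 5. \<forall>u. 0 < \<bar>u\<bar> \<longrightarrow> \<bar>u\<bar> < \<delta> \<longrightarrow> dist (arc_bracket F G y u) y < \<eta> * \<bar>u\<bar>"
    and x: "x \<in> D 3" and s: "0 \<le> s" "s < \<tau>" and t: "0 \<le> t" "t < \<tau>"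
  shows "F (G x s) t = G (F x t) s"
proof -
  have approx: "dist (F (G x s) t) (G (F x t) s) \<le> s * t * L ^ 4 * \<eta> + 2 * (L + 1) * C * h"
    if h: "0 < h" "h < \<tau>" and \<eta>: "0 \<le> \<eta>"
      and A: "\<And>y. y \<in> D 5 \<Longrightarrow> dist (arc_bracket F G y (h\<^sup>2)) y \<le> \<eta> * h\<^sup>2" for h \<eta>
  proof -
    define p q where "p = nat \<lfloor>t / h\<rfloor>" and "q = nat \<lfloor>s / h\<rfloor>"
    have floor: "real (nat \<lfloor>a / h\<rfloor>) * h \<le> a" "a - real (nat \<lfloor>a / h\<rfloor>) * h \<le> h" if "0 \<le> a" for a
    proof -
      have "real (nat \<lfloor>a / h\<rfloor>) \<le> a / h" "a / h \<le> real (nat \<lfloor>a / h\<rfloor>) + 1"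
        using floor_correct[of "a / h"] divide_nonneg_pos[OF that h(1)] by simp_all
      then show "real (nat \<lfloor>a / h\<rfloor>) * h \<le> a" "a - real (nat \<lfloor>a / h\<rfloor>) * h \<le> h"
        using h by (auto simp: field_simps)
    qed
    define t' s' where "t' = real p * h" and "s' = real q * h"
    have t': "0 \<le> t'" "t' \<le> t" "t' < \<tau>" "\<bar>t - t'\<bar> \<le> h" "\<bar>t' - t\<bar> \<le> h"
      using floor[OF t(1)] t h by (auto simp: t'_def p_def)
    have s': "0 \<le> s'" "s' \<le> s" "s' < \<tau>" "\<bar>s - s'\<bar> \<le> h" "\<bar>s' - s\<bar> \<le> h"
      using floor[OF s(1)] s h by (auto simp: s'_def q_def)
    have x10: "x \<in> D 10" by (rule D_mono[OF x]) simp
    have Ch: "C * \<bar>a\<bar> \<le> C * h" if "\<bar>a\<bar> \<le> h" for a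
      using that F.C_nonneg by (intro mult_left_mono) auto
    have LCh: "L * a \<le> L * (C * h)" if "a \<le> C * h" for a
      using that F.L_ge_1 by (intro mult_left_mono) auto
    have D: "G x s \<in> D 10" "G x s' \<in> D 10" "F x t \<in> D 10" "F x t' \<in> D 10"
      using s t s' t' F_move[OF x, of 10] G_move[OF x, of 10] by simp_all
    have "dist (F (G x s) t) (F (G x s') t) \<le> L * dist (G x s) (G x s')"
      using D t by (intro F.lipschitz_space) auto
    also have "\<dots> \<le> L * (C * h)"
      using x10 s s' by (intro LCh order_trans[OF G.lipschitz_time Ch]) auto
    finally have d1: "dist (F (G x s) t) (F (G x s') t) \<le> L * (C * h)" .
    have d2: "dist (F (G x s') t) (F (G x s') t') \<le> C * h"
      using D t t' by (intro order_trans[OF F.lipschitz_time Ch]) auto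
    have "dist (F (G x s') t') (G (F x t') s') \<le> real p * real q * L ^ 4 * (\<eta> * h\<^sup>2)"
      unfolding t'_def s'_def using x h t'(3) s'(3) A by (intro grid_swap) (auto simp: t'_def s'_def)
    also have "\<dots> = (s' * t') * (L ^ 4 * \<eta>)" by (simp add: t'_def s'_def power2_eq_square)
    also have "\<dots> \<le> (s * t) * (L ^ 4 * \<eta>)"
      using s' t' \<eta> F.L_ge_1 s t by (intro mult_right_mono mult_mono) auto
    finally have d3: "dist (F (G x s') t') (G (F x t') s') \<le> s * t * L ^ 4 * \<eta>" by (simp add: mult.assoc)
    have d4: "dist (G (F x t') s') (G (F x t') s) \<le> C * h"
      using D s s' by (intro order_trans[OF G.lipschitz_time Ch]) auto
    have "dist (G (F x t') s) (G (F x t) s) \<le> L * dist (F x t') (F x t)"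
      using D s by (intro G.lipschitz_space) auto
    also have "\<dots> \<le> L * (C * h)"
      using x10 t t' by (intro LCh order_trans[OF F.lipschitz_time Ch]) auto
    finally have d5: "dist (G (F x t') s) (G (F x t) s) \<le> L * (C * h)" .
    have "dist (F (G x s) t) (G (F x t) s) \<le> dist (F (G x s) t) (F (G x s') t)
        + dist (F (G x s') t) (F (G x s') t') + dist (F (G x s') t') (G (F x t') s')
        + dist (G (F x t') s') (G (F x t') s) + dist (G (F x t') s) (G (F x t) s)"
      by (smt (verit) dist_triangle)
    then show ?thesis using d1 d2 d3 d4 d5 by (simp add: algebra_simps)
  qed
  have "dist (F (G x s) t) (G (F x t) s) \<le> s * t * L ^ 4 * \<eta>" if \<eta>: "\<eta> > 0" for \<eta>
  proof -
    obtain \<delta> where \<delta>: "\<delta> > 0" and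
      br: "\<And>y u. y \<in> D 5 \<Longrightarrow> 0 < \<bar>u\<bar> \<Longrightarrow> \<bar>u\<bar> < \<delta> \<Longrightarrow> dist (arc_bracket F G y u) y < \<eta> * \<bar>u\<bar>"
      using bracket[OF \<eta>] by blast
    have "dist (F (G x s) t) (G (F x t) s) \<le> s * t * L ^ 4 * \<eta> + 2 * (L + 1) * C * h"
      if h: "h \<in> {0<..<min \<tau> (sqrt \<delta>)}" for h
    proof (rule approx)
      have "h\<^sup>2 < \<delta>" using h real_less_rsqrt[of h \<delta>] \<delta>
        by (metis greaterThanLessThan_iff less_imp_le min_less_iff_conj real_sqrt_less_iff real_sqrt_unique)
      then show "dist (arc_bracket F G y (h\<^sup>2)) y \<le> \<eta> * h\<^sup>2" if "y \<in> D 5" for y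
        using br[OF that, of "h\<^sup>2"] h by simp
    qed (use h \<eta> in auto)
    then have "\<forall>\<^sub>F h in at_right 0.
        dist (F (G x s) t) (G (F x t) s) \<le> s * t * L ^ 4 * \<eta> + 2 * (L + 1) * C * h"
      using \<tau>_pos \<delta> by (intro eventually_mono[OF eventually_at_right_real[of 0 "min \<tau> (sqrt \<delta>)"]]) auto
    moreover have "((\<lambda>h. s * t * L ^ 4 * \<eta> + 2 * (L + 1) * C * h) \<longlongrightarrow>
        s * t * L ^ 4 * \<eta> + 2 * (L + 1) * C * 0) (at_right 0)"
      by (intro tendsto_intros)
    ultimately have "dist (F (G x s) t) (G (F x t) s) \<le> s * t * L ^ 4 * \<eta> + 2 * (L + 1) * C * 0"
      by (rule_tac tendsto_lowerbound) auto
    then show ?thesis by simp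
  qed
  then have "\<forall>\<^sub>F \<eta> in at_right 0. dist (F (G x s) t) (G (F x t) s) \<le> s * t * L ^ 4 * \<eta>"
    by (intro eventually_mono[OF eventually_at_right_real[of 0 1]]) auto
  moreover have "((\<lambda>\<eta>. s * t * L ^ 4 * \<eta>) \<longlongrightarrow> s * t * L ^ 4 * 0) (at_right 0)"
    by (intro tendsto_intros)
  ultimately have "dist (F (G x s) t) (G (F x t) s) \<le> s * t * L ^ 4 * 0"
    by (rule_tac tendsto_lowerbound) auto
  then show ?thesis by simp
qed

text \<open>
  For \<open>s < 0\<close> the identity at \<open>x\<close> is the one for \<open>-s\<close> at the base point \<open>G x s\<close>, and likewise for
  \<open>t\<close>. Each change of base point uses up one step of the radius.
\<close>
lemma commute_nonneg_imp_commute: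
  assumes nonneg: "\<And>x s t. x \<in> D 3 \<Longrightarrow> 0 \<le> s \<Longrightarrow> s < \<tau> \<Longrightarrow> 0 \<le> t \<Longrightarrow> t < \<tau> \<Longrightarrow>
      F (G x s) t = G (F x t) s"
    and x: "x \<in> D 1" and st: "\<bar>s\<bar> < \<tau>" "\<bar>t\<bar> < \<tau>"
  shows "F (G x s) t = G (F x t) s"
proof -
  have half: "F (G x s) t = G (F x t) s"
    if x: "x \<in> D 2" and s: "\<bar>s\<bar> < \<tau>" and t: "0 \<le> t" "t < \<tau>" for x s t
  proof (cases "0 \<le> s")
    case True
    then show ?thesis using s t by (intro nonneg D_mono[OF x]) auto
  next
    case False
    have y: "G x s \<in> D 3" using x s by (intro G_move[of _ 2]) auto
    have "G (F x t) s = G (F (G (G x s) (- s)) t) s"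
      using G_cancel[OF D_mono[OF x], of s] s by simp
    also have "\<dots> = G (G (F (G x s) t) (- s)) s"
      using nonneg[OF y, of "- s" t] False s t by simp
    also have "\<dots> = F (G x s) t"
      using s t by (intro G_cancel' F_move[OF y]) auto
    finally show ?thesis by simp
  qed
  show ?thesis
  proof (cases "0 \<le> t")
    case True
    then show ?thesis using st by (intro half D_mono[OF x]) auto
  next
    case False
    have y: "F x t \<in> D 2" using x st by (intro F_move[of _ 1]) auto
    have "F (G x s) t = F (G (F (F x t) (- t)) s) t"
      using F_cancel[OF D_mono[OF x], of t] st by simp
    also have "\<dots> = F (F (G (F x t) s) (- t)) t"
      using half[OF y, of s "- t"] False st by simp
    also have "\<dots> = G (F x t) s"
      using st by (intro F_cancel' G_move[OF y]) auto
    finally show ?thesis .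
  qed
qed

end

lemma ex_flow_box_pair:
  assumes "\<exists>R>0. \<exists>T C L. flow_box F (ball x\<^sub>0 R) T C L"
    and "\<exists>R>0. \<exists>T C L. flow_box G (ball x\<^sub>0 R) T C L"
    and "0 < r"
  shows "\<exists>c \<tau> C L. flow_box_pair F G x\<^sub>0 c \<tau> C L \<and> 10 * c \<le> r"
proof -
  obtain R\<^sub>1 T\<^sub>1 C\<^sub>1 L\<^sub>1 where R\<^sub>1: "R\<^sub>1 > 0" and box\<^sub>1: "flow_box F (ball x\<^sub>0 R\<^sub>1) T\<^sub>1 C\<^sub>1 L\<^sub>1"
    using assms(1) by blast
  obtain R\<^sub>2 T\<^sub>2 C\<^sub>2 L\<^sub>2 where R\<^sub>2: "R\<^sub>2 > 0" and box\<^sub>2: "flow_box G (ball x\<^sub>0 R\<^sub>2) T\<^sub>2 C\<^sub>2 L\<^sub>2"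
    using assms(2) by blast
  interpret F: flow_box F "ball x\<^sub>0 R\<^sub>1" T\<^sub>1 C\<^sub>1 L\<^sub>1 by (fact box\<^sub>1)
  interpret G: flow_box G "ball x\<^sub>0 R\<^sub>2" T\<^sub>2 C\<^sub>2 L\<^sub>2 by (fact box\<^sub>2)
  define c where "c = min (min R\<^sub>1 R\<^sub>2) r / 10"
  define C where "C = max C\<^sub>1 C\<^sub>2"
  define \<tau> where "\<tau> = min (min T\<^sub>1 T\<^sub>2 / 2) (c / (C + 1))"
  have c: "0 < c" "10 * c \<le> R\<^sub>1" "10 * c \<le> R\<^sub>2" "10 * c \<le> r"
    using R\<^sub>1 R\<^sub>2 assms(3) by (auto simp: c_def)
  have C: "0 \<le> C" "C\<^sub>1 \<le> C" "C\<^sub>2 \<le> C" using F.C_nonneg by (auto simp: C_def)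
  have \<tau>: "0 < 2 * \<tau>" "2 * \<tau> \<le> T\<^sub>1" "2 * \<tau> \<le> T\<^sub>2"
    using F.T_pos G.T_pos c C by (auto simp: \<tau>_def)
  have "flow_box F (ball x\<^sub>0 (10 * c)) (2 * \<tau>) C (max L\<^sub>1 L\<^sub>2)"
    using c C \<tau> by (intro flow_box_mono[OF box\<^sub>1] subset_ball) auto
  moreover have "flow_box G (ball x\<^sub>0 (10 * c)) (2 * \<tau>) C (max L\<^sub>1 L\<^sub>2)"
    using c C \<tau> by (intro flow_box_mono[OF box\<^sub>2] subset_ball) auto
  moreover have "C * \<tau> \<le> c"
  proof -
    have "C * \<tau> \<le> C * (c / (C + 1))" using C by (intro mult_left_mono) (auto simp: \<tau>_def)
    also have "\<dots> \<le> c" using C c by (simp add: field_simps)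
    finally show ?thesis .
  qed
  ultimately have "flow_box_pair F G x\<^sub>0 c \<tau> C (max L\<^sub>1 L\<^sub>2)"
    using c by (simp add: flow_box_pair_def flow_box_pair_axioms_def)
  then show ?thesis using c by blast
qed

theorem theorem45:
  fixes X Y F G :: "'a::metric_space \<Rightarrow> real \<Rightarrow> 'a"
  assumes "locally_complete TYPE('a)"
    and "arc_field X" and "cond_E1 X" and "cond_E2 X"
    and "arc_field Y" and "cond_E1 Y" and "cond_E2 Y"
    and "local_flow X F" and "local_flow Y G"
  shows "(arc_tangent (arc_bracket F G) zero_arc \<longleftrightarrow> locally_commute F G) \<and>
         (locally_commute F G \<longleftrightarrow> locally_pullback_invariant F G)"
proof -
  have box: "\<exists>c \<tau> C L. flow_box_pair F G x\<^sub>0 c \<tau> C L \<and> 10 * c \<le> r" if "0 < r" for x\<^sub>0 r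
    using assms that by (intro ex_flow_box_pair local_flow_box)
  \<comment> \<open>A single \<open>\<delta>\<close> bounds both the base points and the times.\<close>
  have small: "\<exists>\<delta>>0. \<forall>x\<in>ball x\<^sub>0 \<delta>. \<forall>s t. \<bar>s\<bar> < \<delta> \<longrightarrow> \<bar>t\<bar> < \<delta> \<longrightarrow> P x s t"
    if "0 < c" "0 < \<tau>" "0 < d"
      and "\<And>x s t. x \<in> ball x\<^sub>0 c \<Longrightarrow> x \<in> ball x\<^sub>0 d \<Longrightarrow> \<bar>s\<bar> < d \<Longrightarrow> \<bar>t\<bar> < d \<Longrightarrow>
        \<bar>s\<bar> < \<tau> \<Longrightarrow> \<bar>t\<bar> < \<tau> \<Longrightarrow> P x s t"
    for c \<tau> d :: real and x\<^sub>0 :: 'a and P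
    using that by (intro exI[of _ "min d (min c \<tau>)"]) auto
  have "locally_commute F G" if tangent: "arc_tangent (arc_bracket F G) zero_arc"
    unfolding locally_commute_def
  proof
    fix x\<^sub>0
    obtain r where "r > 0" and r: "\<And>\<eta>. \<eta> > 0 \<Longrightarrow> \<exists>\<delta>>0. \<forall>x\<in>ball x\<^sub>0 r. \<forall>t. 0 < \<bar>t\<bar> \<longrightarrow> \<bar>t\<bar> < \<delta> \<longrightarrow>
        dist (arc_bracket F G x t) x < \<eta> * \<bar>t\<bar>"
      using tangent unfolding arc_tangent_def zero_arc_def by metis
    obtain c \<tau> C L where pair: "flow_box_pair F G x\<^sub>0 c \<tau> C L" and c: "10 * c \<le> r"
      using box[OF \<open>r > 0\<close>] by blast
    interpret flow_box_pair F G x\<^sub>0 c \<tau> C L by (fact pair)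
    have "D 5 \<subseteq> ball x\<^sub>0 r" using c c_pos by (intro subset_ball) simp
    then have "\<exists>\<delta>>0. \<forall>y\<in>D 5. \<forall>u. 0 < \<bar>u\<bar> \<longrightarrow> \<bar>u\<bar> < \<delta> \<longrightarrow>
        dist (arc_bracket F G y u) y < \<eta> * \<bar>u\<bar>" if "\<eta> > 0" for \<eta>
      using r[OF that] by blast
    note * = small_bracket_imp_commute_nonneg[OF this]
    show "\<exists>\<delta>>0. \<forall>x\<in>ball x\<^sub>0 \<delta>. \<forall>s t. \<bar>s\<bar> < \<delta> \<longrightarrow> \<bar>t\<bar> < \<delta> \<longrightarrow> F (G x s) t = G (F x t) s"
      using c_pos \<tau>_pos \<tau>_pos by (rule small) (rule commute_nonneg_imp_commute[OF *], auto)
  qed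
  moreover have "arc_tangent (arc_bracket F G) zero_arc" if comm: "locally_commute F G"
    unfolding arc_tangent_def zero_arc_def
  proof
    fix x\<^sub>0
    obtain d where "d > 0" and d: "\<And>x s t. x \<in> ball x\<^sub>0 d \<Longrightarrow> \<bar>s\<bar> < d \<Longrightarrow> \<bar>t\<bar> < d \<Longrightarrow>
        F (G x s) t = G (F x t) s"
      using comm unfolding locally_commute_def by metis
    obtain c \<tau> C L where pair: "flow_box_pair F G x\<^sub>0 c \<tau> C L"
      using box[OF zero_less_one, of x\<^sub>0] by blast
    interpret flow_box_pair F G x\<^sub>0 c \<tau> C L by (fact pair)
    have trivial: "arc_bracket F G x t = x"
      if "x \<in> ball x\<^sub>0 (min c d)" "\<bar>t\<bar> < (min \<tau> d)\<^sup>2" for x t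
    proof -
      have "sqrt \<bar>t\<bar> < min \<tau> d"
        using that(2) \<tau>_pos \<open>d > 0\<close> by (intro real_less_lsqrt) auto
      then show ?thesis using that(1) by (intro commute_imp_bracket_trivial d) auto
    qed
    have "dist (arc_bracket F G x t) x < \<epsilon> * \<bar>t\<bar>"
      if "0 < \<epsilon>" "x \<in> ball x\<^sub>0 (min c d)" "0 < \<bar>t\<bar>" "\<bar>t\<bar> < (min \<tau> d)\<^sup>2" for \<epsilon> x t
      using that trivial[of x t] by simp
    moreover have "0 < min c d" "0 < (min \<tau> d)\<^sup>2" using c_pos \<tau>_pos \<open>d > 0\<close> by auto
    ultimately show "\<exists>r>0. \<forall>\<epsilon>>0. \<exists>\<delta>>0. \<forall>x\<in>ball x\<^sub>0 r. \<forall>t. 0 < \<bar>t\<bar> \<longrightarrow> \<bar>t\<bar> < \<delta> \<longrightarrow>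
        dist (arc_bracket F G x t) x < \<epsilon> * \<bar>t\<bar>"
      by blast
  qed
  moreover have "locally_commute F G \<longleftrightarrow> locally_pullback_invariant F G"
  proof
    assume comm: "locally_commute F G"
    show "locally_pullback_invariant F G"
      unfolding locally_pullback_invariant_def
    proof
      fix x\<^sub>0
      obtain d where "d > 0" and d: "\<And>x s t. x \<in> ball x\<^sub>0 d \<Longrightarrow> \<bar>s\<bar> < d \<Longrightarrow> \<bar>t\<bar> < d \<Longrightarrow>
          F (G x s) t = G (F x t) s"
        using comm unfolding locally_commute_def by metis
      obtain c \<tau> C L where pair: "flow_box_pair F G x\<^sub>0 c \<tau> C L"
        using box[OF zero_less_one, of x\<^sub>0] by blast
      interpret flow_box_pair F G x\<^sub>0 c \<tau> C L by (fact pair)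
      show "\<exists>\<delta>>0. \<forall>x\<in>ball x\<^sub>0 \<delta>. \<forall>s t. \<bar>s\<bar> < \<delta> \<longrightarrow> \<bar>t\<bar> < \<delta> \<longrightarrow> arc_pullback F t G x s = G x s"
        using c_pos \<tau>_pos \<open>d > 0\<close>
        by (rule small) (rule commute_iff_pullback[THEN iffD1, OF _ _ _ d], auto)
    qed
  next
    assume inv: "locally_pullback_invariant F G"
    show "locally_commute F G"
      unfolding locally_commute_def
    proof
      fix x\<^sub>0
      obtain d where "d > 0" and d: "\<And>x s t. x \<in> ball x\<^sub>0 d \<Longrightarrow> \<bar>s\<bar> < d \<Longrightarrow> \<bar>t\<bar> < d \<Longrightarrow>
          arc_pullback F t G x s = G x s"
        using inv unfolding locally_pullback_invariant_def by metis
      obtain c \<tau> C L where pair: "flow_box_pair F G x\<^sub>0 c \<tau> C L"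
        using box[OF zero_less_one, of x\<^sub>0] by blast
      interpret flow_box_pair F G x\<^sub>0 c \<tau> C L by (fact pair)
      show "\<exists>\<delta>>0. \<forall>x\<in>ball x\<^sub>0 \<delta>. \<forall>s t. \<bar>s\<bar> < \<delta> \<longrightarrow> \<bar>t\<bar> < \<delta> \<longrightarrow> F (G x s) t = G (F x t) s"
        using c_pos \<tau>_pos \<open>d > 0\<close>
        by (rule small) (rule commute_iff_pullback[THEN iffD2, OF _ _ _ d], auto)
    qed
  qed
  ultimately show ?thesis by blast
qed

end
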